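(* Let $Q$ be a quiver without oriented cycles and let $\theta\in\mathbb{Z}^{Q_0}$ be an integer weight such that the quiver polytope $\nabla(Q,\theta)$ is non-empty. (i) If $\dim(\nabla(Q,\theta))\le 3$, then the toric ideal $\mathcal{I}(Q,\theta)$ is generated in degree two. (ii) If $\dim(\nabla(Q,\theta))=4$, then either $\mathcal{I}(Q,\theta)$ is generated in degree two, or $\nabla(Q,\theta)$ is integral-affinely equivalent to the Birkhoff polytope $B_3$, in which case $\mathcal{I}(Q,\theta)$ is generated by a single cubic element and some quadratic elements.
   Context: A quiver $Q$ is a finite directed graph with vertex set $Q_0$ and arrow set $Q_1$ (multiple arrows allowed); an arrow $a$ goes from $a^-$ to $a^+$. For $\theta\in\mathbb{Z}^{Q_0}$ the quiver polytope is $$\nabla(Q,\theta)=\{x\in\mathbb{R}^{Q_1}_{\ge 0}\mid \forall v\in Q_0:\ \theta(v)=\sum_{a^+=v}x(a)-\sum_{a^-=v}x(a)\},$$ considered with the lattice $\mathbb{Z}^{Q_1}\subset\mathbb{R}^{Q_1}$. When $Q$ has no oriented cycles this is a lattice polytope which is normal (every lattice point of $k\nabla$ is a sum of $k$ lattice points of $\nabla$, for all $k\ge1$). Toric ideal: let $\nabla\subset\mathbb{R}^d$ be a normal lattice polytope with lattice points $m_1,\dots,m_k$, let $S(\nabla)=\{(m,\lambda)\in\mathbb{Z}^d\times\mathbb{Z}\mid \lambda\ge 0,\ m\in\lambda\nabla\}$, and let $\varphi:\mathbb{C}[t_1,\dots,t_k]\to\mathbb{C}[S(\nabla)]$ be the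 surjective $\mathbb{C}$-algebra homomorphism sending $t_i$ to the semigroup element $x^{(m_i,1)}$. The toric ideal of $\nabla$ is $\mathcal{I}(\nabla)=\ker(\varphi)$, a homogeneous ideal for the standard grading; $\mathcal{I}(Q,\theta):=\mathcal{I}(\nabla(Q,\theta))$. An ideal is "generated in degree two" if it is generated by elements of degree at most two (or is zero). Two lattice polytopes $\nabla_i\subset V_i$ with lattices $M_i\subset V_i$ ($i=1,2$) are integral-affinely equivalent if there is an affine linear isomorphism $\mathrm{AffSpan}(\nabla_1)\to\mathrm{AffSpan}(\nabla_2)$ mapping $\mathrm{AffSpan}(\nabla_1)\cap M_1$ onto $\mathrm{AffSpan}(\nabla_2)\cap M_2$ and $\nabla_1$ onto $\nabla_2$. The Birkhoff polytope $B_3\subset\mathbb{R}^{3\times3}$ is the convex hull of the $3\times 3$ permutation matrices (with lattice $\mathbb{Z}^{3\times 3}$). *)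

theory Defs
  imports
    "HOL-Algebra.RingHom"
    "Graph_Theory.Arc_Walk"
    "HOL-Library.Poly_Mapping"
    "HOL-Analysis.Analysis"
begin

section \<open>Quiver polytopes\<close>

text \<open>
  A quiver is a \<^locale>\<open>fin_digraph\<close>; an arrow \<open>a\<close> goes from \<open>tail Q a\<close> to \<open>head Q a\<close>.
  The type \<open>'e\<close> only supplies names for arrows: \<open>arcs Q\<close> may be any (possibly empty) subset of
  it, and the space \<open>\<real>\<^bsup>Q\<^sub>1\<^esup>\<close> is the coordinate subspace of \<open>real ^ 'e\<close> on which the
  coordinates outside \<open>arcs Q\<close> vanish.
\<close>

definition acyclic_quiver :: "('v, 'e) pre_digraph \<Rightarrow> bool" where
  "acyclic_quiver Q \<longleftrightarrow> (\<nexists>p. pre_digraph.cycle Q p)"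

definition quiver_polytope :: "('v, 'e::finite) pre_digraph \<Rightarrow> ('v \<Rightarrow> int) \<Rightarrow> (real ^ 'e) set" where
  "quiver_polytope Q \<theta> =
    {x. (\<forall>a\<in>arcs Q. 0 \<le> x $ a) \<and> (\<forall>a. a \<notin> arcs Q \<longrightarrow> x $ a = 0) \<and>
        (\<forall>v\<in>verts Q. real_of_int (\<theta> v) = (\<Sum>a\<in>in_arcs Q v. x $ a) - (\<Sum>a\<in>out_arcs Q v. x $ a))}"


section \<open>Lattice points and integral-affine equivalence\<close>

definition real_vec :: "int ^ 'n \<Rightarrow> real ^ 'n" where
  "real_vec m = (\<chi> i. real_of_int (m $ i))"

definition lattice_points :: "(real ^ 'n) set \<Rightarrow> (int ^ 'n) set" where
  "lattice_points P = {m. real_vec m \<in> P}"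

definition affine_map_on :: "'a::real_vector set \<Rightarrow> ('a \<Rightarrow> 'b::real_vector) \<Rightarrow> bool" where
  "affine_map_on A f \<longleftrightarrow>
    (\<forall>x\<in>A. \<forall>y\<in>A. \<forall>u v. u + v = 1 \<longrightarrow> f (u *\<^sub>R x + v *\<^sub>R y) = u *\<^sub>R f x + v *\<^sub>R f y)"

text \<open>The lattice in \<open>real ^ 'n\<close> is always the set \<open>range real_vec\<close> of integer vectors.\<close>

definition integral_affinely_equivalent :: "(real ^ 'n) set \<Rightarrow> (real ^ 'm) set \<Rightarrow> bool" where
  "integral_affinely_equivalent P P' \<longleftrightarrow>
    (\<exists>f. affine_map_on (affine hull P) f \<and>
         bij_betw f (affine hull P) (affine hull P') \<and>
         f ` (affine hull P \<inter> range real_vec) = affine hull P' \<inter> range real_vec \<and>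
         f ` P = P')"

definition Birkhoff3 :: "(real ^ (3 \<times> 3)) set" where
  "Birkhoff3 = convex hull {(\<chi> ij. if \<pi> (fst ij) = snd ij then 1 else 0) | \<pi> :: 3 \<Rightarrow> 3. bij \<pi>}"


section \<open>Toric ideals\<close>

text \<open>
  The product of \<^typ>\<open>'s::comm_monoid_add \<Rightarrow>\<^sub>0 complex\<close> is convolution, so this type is the
  monoid algebra of \<open>'s\<close>, with \<^term>\<open>Poly_Mapping.single s (1::complex)\<close> as the basis element
  \<open>x\<^sup>s\<close>.  The following is the subalgebra spanned by \<open>S\<close>, for a submonoid \<open>S\<close>.
\<close>

definition monoid_algebra :: "'s::comm_monoid_add set \<Rightarrow> ('s \<Rightarrow>\<^sub>0 complex) ring" where
  "monoid_algebra S =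
    \<lparr>carrier = {f. Poly_Mapping.keys f \<subseteq> S}, monoid.mult = (*), one = 1, zero = 0, add = (+)\<rparr>"

text \<open>
  \<open>\<complex>[t\<^sub>x | x \<in> X]\<close> is the monoid algebra of the free commutative monoid on \<open>X\<close>:
  \<open>\<mu> :: 'x \<Rightarrow>\<^sub>0 nat\<close> stands for the monomial with exponents \<open>\<mu>\<close>.
\<close>

definition poly_ring :: "'x set \<Rightarrow> (('x \<Rightarrow>\<^sub>0 nat) \<Rightarrow>\<^sub>0 complex) ring" where
  "poly_ring X = monoid_algebra {\<mu>. Poly_Mapping.keys \<mu> \<subseteq> X}"

definition monom_degree :: "('x \<Rightarrow>\<^sub>0 nat) \<Rightarrow> nat" where
  "monom_degree \<mu> = (\<Sum>x\<in>Poly_Mapping.keys \<mu>. Poly_Mapping.lookup \<mu> x)"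

definition degree_at_most :: "nat \<Rightarrow> (('x \<Rightarrow>\<^sub>0 nat) \<Rightarrow>\<^sub>0 complex) \<Rightarrow> bool" where
  "degree_at_most d p \<longleftrightarrow> (\<forall>\<mu>\<in>Poly_Mapping.keys p. monom_degree \<mu> \<le> d)"

text \<open>As usual, the zero polynomial is homogeneous of every degree.\<close>

definition homogeneous_of_degree :: "nat \<Rightarrow> (('x \<Rightarrow>\<^sub>0 nat) \<Rightarrow>\<^sub>0 complex) \<Rightarrow> bool" where
  "homogeneous_of_degree d p \<longleftrightarrow> (\<forall>\<mu>\<in>Poly_Mapping.keys p. monom_degree \<mu> = d)"

definition lattice_semigroup :: "(real ^ 'n) set \<Rightarrow> ((int ^ 'n) \<times> int) set" where
  "lattice_semigroup P = {(m, k). 0 \<le> k \<and> real_vec m \<in> (\<lambda>x. real_of_int k *\<^sub>R x) ` P}"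

text \<open>
  The variables are indexed by the lattice points of the polytope themselves. The map is the
  evaluation homomorphism \<open>t\<^sub>m \<mapsto> x\<^bsup>(m, 1)\<^esup>\<close>.
\<close>

definition toric_hom ::
  "((int ^ 'n \<Rightarrow>\<^sub>0 nat) \<Rightarrow>\<^sub>0 complex) \<Rightarrow> ((int ^ 'n) \<times> int \<Rightarrow>\<^sub>0 complex)" where
  "toric_hom p =
    (\<Sum>\<mu>\<in>Poly_Mapping.keys p. Poly_Mapping.single 0 (Poly_Mapping.lookup p \<mu>) *
       (\<Prod>m\<in>Poly_Mapping.keys \<mu>. Poly_Mapping.single (m, 1) 1 ^ Poly_Mapping.lookup \<mu> m))"

lemma toric_hom_variable:
  "toric_hom (Poly_Mapping.single (Poly_Mapping.single m 1) 1) = Poly_Mapping.single (m, 1) 1"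
  by (simp add: toric_hom_def)

definition toric_ideal :: "(real ^ 'n) set \<Rightarrow> ((int ^ 'n \<Rightarrow>\<^sub>0 nat) \<Rightarrow>\<^sub>0 complex) set" where
  "toric_ideal P =
    a_kernel (poly_ring (lattice_points P)) (monoid_algebra (lattice_semigroup P)) toric_hom"

definition toric_ideal_generated_by ::
  "(real ^ 'n) set \<Rightarrow> ((int ^ 'n \<Rightarrow>\<^sub>0 nat) \<Rightarrow>\<^sub>0 complex) set \<Rightarrow> bool" where
  "toric_ideal_generated_by P G \<longleftrightarrow>
    G \<subseteq> carrier (poly_ring (lattice_points P)) \<and>
    toric_ideal P = Idl\<^bsub>poly_ring (lattice_points P)\<^esub> G"

text \<open>The zero ideal is covered by the empty set of generators.\<close>

definition generated_in_degree_two :: "(real ^ 'n) set \<Rightarrow> bool" where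
  "generated_in_degree_two P \<longleftrightarrow>
    (\<exists>G. toric_ideal_generated_by P G \<and> (\<forall>g\<in>G. degree_at_most 2 g))"

definition generated_by_cubic_and_quadrics :: "(real ^ 'n) set \<Rightarrow> bool" where
  "generated_by_cubic_and_quadrics P \<longleftrightarrow>
    (\<exists>c G. toric_ideal_generated_by P (insert c G) \<and>
       c \<noteq> 0 \<and> homogeneous_of_degree 3 c \<and> (\<forall>g\<in>G. homogeneous_of_degree 2 g))"

end

theory Submission
  imports Defs
begin

text \<open>
  The toric ideal is spanned by the differences of monomials \<open>t\<^sup>M - t\<^sup>N\<close> for multisets \<open>M\<close>, \<open>N\<close> of
  lattice points with the same size and sum, so one has to connect \<open>M\<close> to \<open>N\<close> by quadratic moves,
  which replace two members by two others with the same sum.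

  Integral flows can be rounded, so quadratic moves make any two members of \<open>M\<close> differ by at most
  \<open>1\<close> in each coordinate. Then \<open>M\<close> and \<open>N\<close> lie in the same unit box. If some member \<open>v\<close> of \<open>M\<close> and
  some member \<open>w\<close> of \<open>N\<close> occur in a common factorization, \<open>M\<close> and \<open>N\<close> are connected by induction on
  the size \<open>k\<close>. Otherwise each pair \<open>y\<^sub>i \<in> M\<close>, \<open>z\<^sub>j \<in> N\<close> is blocked by a coordinate, that is, by an affine
  function \<open>h\<^sub>i\<^sub>j\<close> which is \<open>1\<close> at \<open>y\<^sub>i\<close> and \<open>z\<^sub>j\<close> and \<open>0\<close> at all other members. These force the
  polytope to have dimension at least \<open>2k - 2\<close>, where \<open>k \<ge> 3\<close>.

  In dimension 4 this leaves \<open>k = 3\<close>, and the \<open>y\<^sub>i\<close>, \<open>z\<^sub>j\<close> span the polytope. If all \<open>h\<^sub>i\<^sub>j\<close> are nonnegative on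
  it, it is their convex hull and the \<open>h\<^sub>i\<^sub>j\<close> are the matrix entries identifying it with the Birkhoff
  polytope. If some \<open>h\<^sub>i\<^sub>j\<close> takes a negative value, the sum of the two other \<open>y\<close>'s minus \<open>z\<^sub>j\<close> is a further
  lattice point, through which \<open>M\<close> and \<open>N\<close> are connected after all.
\<close>

section \<open>Toric ideals and binomials\<close>

lemma cring_monoid_algebra:
  assumes "0 \<in> S" and "\<And>a b. a \<in> S \<Longrightarrow> b \<in> S \<Longrightarrow> a + b \<in> S"
  shows "cring (monoid_algebra S)"
proof (rule cringI)
  show "abelian_group (monoid_algebra S)"
  proof (rule abelian_groupI)
    fix x assume "x \<in> carrier (monoid_algebra S)"
    then show "\<exists>y\<in>carrier (monoid_algebra S). y \<oplus>\<^bsub>monoid_algebra S\<^esub> x = \<zero>\<^bsub>monoid_algebra S\<^esub>"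
      by (intro bexI[of _ "- x"]) (auto simp: monoid_algebra_def)
  qed (use keys_add in \<open>fastforce simp: monoid_algebra_def add.assoc add.commute\<close>)+
  show "Group.comm_monoid (monoid_algebra S)"
  proof (rule comm_monoidI)
    fix x y assume "x \<in> carrier (monoid_algebra S)" "y \<in> carrier (monoid_algebra S)"
    then show "x \<otimes>\<^bsub>monoid_algebra S\<^esub> y \<in> carrier (monoid_algebra S)"
      using keys_mult[of x y] assms(2) by (fastforce simp: monoid_algebra_def)
  qed (use assms in \<open>auto simp: monoid_algebra_def mult.assoc mult.commute\<close>)
qed (simp add: monoid_algebra_def distrib_right)

lemma cring_poly_ring: "cring (poly_ring X)"
  unfolding poly_ring_def
  by (rule cring_monoid_algebra) (use keys_add in fastforce)+

lemma poly_ring_simps: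
  "carrier (poly_ring X) = {f. \<forall>\<mu>\<in>Poly_Mapping.keys f. Poly_Mapping.keys \<mu> \<subseteq> X}"
  "(\<oplus>\<^bsub>poly_ring X\<^esub>) = (+)" "(\<otimes>\<^bsub>poly_ring X\<^esub>) = (*)" "\<zero>\<^bsub>poly_ring X\<^esub> = 0" "\<one>\<^bsub>poly_ring X\<^esub> = 1"
  by (auto simp: poly_ring_def monoid_algebra_def)

text \<open>Negation is multiplication by the constant \<open>- 1\<close>, so closure under sums and
  multiples already makes \<open>J\<close> an additive subgroup.\<close>

lemma ideal_poly_ring_iff:
  "ideal J (poly_ring X) \<longleftrightarrow>
    J \<subseteq> carrier (poly_ring X) \<and> 0 \<in> J \<and> (\<forall>f\<in>J. \<forall>g\<in>J. f + g \<in> J) \<and>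
    (\<forall>f\<in>J. \<forall>g\<in>carrier (poly_ring X). g * f \<in> J)"
proof
  assume "ideal J (poly_ring X)"
  then interpret ideal J "poly_ring X" .
  show "J \<subseteq> carrier (poly_ring X) \<and> 0 \<in> J \<and> (\<forall>f\<in>J. \<forall>g\<in>J. f + g \<in> J) \<and>
    (\<forall>f\<in>J. \<forall>g\<in>carrier (poly_ring X). g * f \<in> J)"
    using a_subset additive_subgroup.zero_closed[OF is_additive_subgroup]
      additive_subgroup.a_closed[OF is_additive_subgroup] I_l_closed
    by (simp add: poly_ring_simps(2-))
next
  assume J: "J \<subseteq> carrier (poly_ring X) \<and> 0 \<in> J \<and> (\<forall>f\<in>J. \<forall>g\<in>J. f + g \<in> J) \<and>
    (\<forall>f\<in>J. \<forall>g\<in>carrier (poly_ring X). g * f \<in> J)"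
  interpret R: cring "poly_ring X" by (rule cring_poly_ring)
  have neg: "\<ominus>\<^bsub>poly_ring X\<^esub> f = - f" if "f \<in> carrier (poly_ring X)" for f
    by (rule R.minus_equality) (use that in \<open>auto simp: poly_ring_simps\<close>)
  have "- 1 \<in> carrier (poly_ring X)"
    by (simp add: poly_ring_simps)
  then have "- f \<in> J" if "f \<in> J" for f
    using J that by (metis mult_minus1)
  moreover have "inv\<^bsub>add_monoid (poly_ring X)\<^esub> f = - f" if "f \<in> J" for f
    using neg[of f] J that by (auto simp: a_inv_def)
  ultimately show "ideal J (poly_ring X)"
    using J
    by (intro idealI R.ring_axioms subgroup.intro)
      (auto simp: poly_ring_simps(2-) mult.commute subset_iff)
qed

section \<open>Monomials as multisets, and their images under the toric homomorphism\<close>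

text \<open>Multisets serve as exponent vectors: products of monomials become unions, and the
  factorizations of the combinatorial argument are the monomials themselves.\<close>

definition monom_of :: "'x multiset \<Rightarrow> 'x \<Rightarrow>\<^sub>0 nat" where
  "monom_of M = (\<Sum>x\<in>#M. Poly_Mapping.single x 1)"

lemma monom_of_simps [simp]:
  "monom_of {#} = 0"
  "monom_of (add_mset x M) = Poly_Mapping.single x 1 + monom_of M"
  "monom_of (M + N) = monom_of M + monom_of N"
  by (simp_all add: monom_of_def)

lemma lookup_monom_of: "Poly_Mapping.lookup (monom_of M) x = count M x"
  by (induction M) (auto simp: lookup_add lookup_single when_def)

lemma keys_monom_of: "Poly_Mapping.keys (monom_of M) = set_mset M"
  by (auto simp: in_keys_iff lookup_monom_of)

lemma monom_of_inject [simp]: "monom_of M = monom_of N \<longleftrightarrow> M = N"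
  by (auto simp: poly_mapping_eq_iff lookup_monom_of multiset_eq_iff fun_eq_iff)

lemma monom_of_surj: obtains M where "\<mu> = monom_of M"
proof
  have "finite {x. 0 < Poly_Mapping.lookup \<mu> x}"
    using finite_keys[of \<mu>] by (simp add: keys.rep_eq)
  then show "\<mu> = monom_of (Abs_multiset (Poly_Mapping.lookup \<mu>))"
    by (auto simp: poly_mapping_eq_iff lookup_monom_of fun_eq_iff count_Abs_multiset)
qed

lemma monom_degree_monom_of: "monom_degree (monom_of M) = size M"
  by (simp add: monom_degree_def keys_monom_of lookup_monom_of size_multiset_overloaded_eq)

abbreviation term_of :: "complex \<Rightarrow> 'x multiset \<Rightarrow> ('x \<Rightarrow>\<^sub>0 nat) \<Rightarrow>\<^sub>0 complex" where
  "term_of c M \<equiv> Poly_Mapping.single (monom_of M) c"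

lemma term_of_in_carrier: "set_mset M \<subseteq> X \<Longrightarrow> term_of c M \<in> carrier (poly_ring X)"
  by (auto simp: poly_ring_simps keys_monom_of)

text \<open>The exponent of the image of the monomial \<open>M\<close> under
  \<open>toric_hom\<close>; two monomials have the same image exactly when they agree in size and
  sum.\<close>

definition weight_of :: "(int ^ 'n) multiset \<Rightarrow> (int ^ 'n) \<times> int" where
  "weight_of M = (\<Sum>m\<in>#M. (m, 1))"

lemma weight_of_eq: "weight_of M = (\<Sum>\<^sub># M, int (size M))"
  by (induction M) (auto simp: weight_of_def zero_prod_def)

lemma weight_of_eq_iff: "weight_of M = weight_of N \<longleftrightarrow> size M = size N \<and> \<Sum>\<^sub># M = \<Sum>\<^sub># N"
  by (auto simp: weight_of_eq)

definition monom_image :: "(int ^ 'n \<Rightarrow>\<^sub>0 nat) \<Rightarrow> ((int ^ 'n) \<times> int \<Rightarrow>\<^sub>0 complex)" where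
  "monom_image \<mu> = (\<Prod>m\<in>Poly_Mapping.keys \<mu>. Poly_Mapping.single (m, 1) 1 ^ Poly_Mapping.lookup \<mu> m)"

lemma monom_image_monom_of: "monom_image (monom_of M) = Poly_Mapping.single (weight_of M) 1"
proof -
  have "monom_image (monom_of M) = (\<Prod>m\<in>set_mset M. Poly_Mapping.single (m, 1) 1 ^ count M m)"
    by (simp add: monom_image_def keys_monom_of lookup_monom_of)
  also have "\<dots> = (\<Prod>m\<in>#M. Poly_Mapping.single (m, 1) (1 :: complex))"
    by (simp add: image_prod_mset_multiplicity)
  also have "\<dots> = Poly_Mapping.single (weight_of M) 1"
    by (induction M) (simp_all add: weight_of_def mult_single)
  finally show ?thesis .
qed

text \<open>Monomials outside the support contribute zero, so polynomials with different supports
  can be evaluated over one common index set; additivity rests on this.\<close>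

lemma toric_hom_sum:
  assumes "finite A" and "Poly_Mapping.keys p \<subseteq> A"
  shows "toric_hom p = (\<Sum>\<mu>\<in>A. Poly_Mapping.single 0 (Poly_Mapping.lookup p \<mu>) * monom_image \<mu>)"
  unfolding toric_hom_def monom_image_def
  by (rule sum.mono_neutral_left) (use assms in \<open>auto simp: in_keys_iff\<close>)

lemma toric_hom_zero [simp]: "toric_hom 0 = 0"
  by (simp add: toric_hom_def)

lemma toric_hom_add: "toric_hom (p + q) = toric_hom p + toric_hom q"
proof -
  let ?A = "Poly_Mapping.keys p \<union> Poly_Mapping.keys q"
  have "toric_hom r = (\<Sum>\<mu>\<in>?A. Poly_Mapping.single 0 (Poly_Mapping.lookup r \<mu>) * monom_image \<mu>)"
    if "Poly_Mapping.keys r \<subseteq> ?A" for r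
    by (rule toric_hom_sum) (use that in auto)
  from this[of p] this[of q] this[of "p + q"] show ?thesis
    using keys_add[of p q]
    by (simp add: lookup_add single_add distrib_right sum.distrib)
qed

lemma toric_hom_diff: "toric_hom (p - q) = toric_hom p - toric_hom q"
  using toric_hom_add[of "p - q" q] by simp

lemma toric_hom_term_of: "toric_hom (term_of c M) = Poly_Mapping.single (weight_of M) c"
proof -
  have "toric_hom (term_of c M)
      = (\<Sum>\<mu>\<in>{monom_of M}. Poly_Mapping.single 0 (Poly_Mapping.lookup (term_of c M) \<mu>) * monom_image \<mu>)"
    by (rule toric_hom_sum) auto
  then show ?thesis
    by (simp add: monom_image_monom_of mult_single)
qed

lemma poly_eq_sum_terms:
  "p = (\<Sum>\<mu>\<in>Poly_Mapping.keys p. Poly_Mapping.single \<mu> (Poly_Mapping.lookup p \<mu>))"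
  by (rule poly_mapping_eqI) (auto simp: lookup_sum lookup_single when_def in_keys_iff)

lemma poly_induct [case_names zero add]:
  assumes "P 0" and "\<And>p M c. P p \<Longrightarrow> P (p + term_of c M)"
  shows "P p"
proof -
  have "P (\<Sum>\<mu>\<in>A. Poly_Mapping.single \<mu> (Poly_Mapping.lookup p \<mu>))" if "finite A" for A
    using that
  proof (induction A rule: finite_induct)
    case (insert \<mu> A)
    obtain M where "\<mu> = monom_of M" by (rule monom_of_surj)
    with insert assms(2)[OF insert.IH, of M "Poly_Mapping.lookup p \<mu>"] show ?case
      by (simp add: add.commute)
  qed (use assms(1) in simp)
  then show ?thesis
    by (metis poly_eq_sum_terms finite_keys)
qed

lemma toric_hom_mult: "toric_hom (p * q) = toric_hom p * toric_hom q"
proof (induction p rule: poly_induct)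
  case (add p M c)
  have "toric_hom (term_of c M * q) = toric_hom (term_of c M) * toric_hom q"
  proof (induction q rule: poly_induct)
    case (add q N d)
    have "toric_hom (term_of c M * term_of d N) = toric_hom (term_of (c * d) (M + N))"
      by (simp add: mult_single)
    also have "\<dots> = toric_hom (term_of c M) * toric_hom (term_of d N)"
      by (simp only: toric_hom_term_of) (simp add: mult_single weight_of_def)
    finally show ?case
      using add by (simp add: distrib_left toric_hom_add)
  qed simp
  with add show ?case
    by (simp add: distrib_right toric_hom_add)
qed simp

lemma toric_ideal_iff:
  "f \<in> toric_ideal P \<longleftrightarrow> f \<in> carrier (poly_ring (lattice_points P)) \<and> toric_hom f = 0"
  by (simp add: toric_ideal_def a_kernel_def' monoid_algebra_def)

lemma ideal_toric_ideal: "ideal (toric_ideal P) (poly_ring (lattice_points P))"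
proof -
  interpret R: cring "poly_ring (lattice_points P)" by (rule cring_poly_ring)
  show ?thesis
    unfolding ideal_poly_ring_iff
    using R.zero_closed R.add.m_closed R.m_closed
    by (auto simp: toric_ideal_iff toric_hom_add toric_hom_mult poly_ring_simps(2-))
qed

section \<open>Binomials and congruences on multisets\<close>

definition binomial_rel ::
  "'x set \<Rightarrow> (('x \<Rightarrow>\<^sub>0 nat) \<Rightarrow>\<^sub>0 complex) set \<Rightarrow> 'x multiset \<Rightarrow> 'x multiset \<Rightarrow> bool" where
  "binomial_rel X J M N \<longleftrightarrow> set_mset M \<subseteq> X \<and> set_mset N \<subseteq> X \<and> term_of 1 M - term_of 1 N \<in> J"

text \<open>In an element of the kernel no monomial is alone in its weight, since its coefficient
  has to cancel. Subtracting a multiple of the binomial that joins it to another monomial of that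
  weight removes it, and induction on the size of the support applies.\<close>

lemma toric_ideal_le:
  assumes J: "ideal J (poly_ring (lattice_points P))"
    and binom: "\<And>M N. set_mset M \<subseteq> lattice_points P \<Longrightarrow> set_mset N \<subseteq> lattice_points P \<Longrightarrow>
      size M = size N \<Longrightarrow> \<Sum>\<^sub># M = \<Sum>\<^sub># N \<Longrightarrow> binomial_rel (lattice_points P) J M N"
  shows "toric_ideal P \<subseteq> J"
proof
  fix f
  assume "f \<in> toric_ideal P"
  then show "f \<in> J"
  proof (induction "card (Poly_Mapping.keys f)" arbitrary: f rule: less_induct)
    case less
    let ?X = "lattice_points P"
    show ?case
    proof (cases "f = 0")
      case True
      then show ?thesis using J by (simp add: ideal_poly_ring_iff)
    next
      case False
      then obtain \<mu> where \<mu>: "\<mu> \<in> Poly_Mapping.keys f"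
        by (metis keys_eq_empty ex_in_conv)
      obtain M where M: "\<mu> = monom_of M" by (rule monom_of_surj)
      have car: "Poly_Mapping.keys \<nu> \<subseteq> ?X" if "\<nu> \<in> Poly_Mapping.keys f" for \<nu>
        using less.prems that by (auto simp: toric_ideal_iff poly_ring_simps)
      \<comment> \<open>If \<open>M\<close> were the only monomial of its weight, the coefficient of
        the image at that weight would be the nonzero coefficient of \<open>\<mu>\<close>.\<close>
      have "\<exists>N. monom_of N \<in> Poly_Mapping.keys f \<and> N \<noteq> M \<and> weight_of N = weight_of M"
      proof (rule ccontr)
        assume no: "\<not> ?thesis"
        have "Poly_Mapping.lookup (Poly_Mapping.single 0 (Poly_Mapping.lookup f \<nu>) * monom_image \<nu>)
            (weight_of M) = (if \<nu> = \<mu> then Poly_Mapping.lookup f \<mu> else 0)"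
          if "\<nu> \<in> Poly_Mapping.keys f" for \<nu>
        proof -
          obtain N where "\<nu> = monom_of N" by (rule monom_of_surj)
          with no that M show ?thesis
            by (auto simp: monom_image_monom_of mult_single lookup_single when_def)
        qed
        then have "Poly_Mapping.lookup (toric_hom f) (weight_of M) = Poly_Mapping.lookup f \<mu>"
          using \<mu> by (simp add: toric_hom_sum[OF finite_keys subset_refl] lookup_sum)
        then show False
          using \<mu> less.prems by (simp add: toric_ideal_iff in_keys_iff)
      qed
      then obtain N where N: "monom_of N \<in> Poly_Mapping.keys f" "N \<noteq> M" "weight_of N = weight_of M"
        by blast
      define c where "c = Poly_Mapping.lookup f \<mu>"
      define g where "g = term_of c M - term_of c N"
      have sub: "set_mset M \<subseteq> ?X" "set_mset N \<subseteq> ?X"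
        using car[OF N(1)] car[OF \<mu>] by (auto simp: M keys_monom_of)
      then have "term_of 1 M - term_of 1 N \<in> J"
        using binom[of M N] N(3) by (simp add: binomial_rel_def weight_of_eq_iff)
      moreover have "Poly_Mapping.single 0 c \<in> carrier (poly_ring ?X)"
        using term_of_in_carrier[of "{#}" ?X c] by simp
      ultimately have "Poly_Mapping.single 0 c * (term_of 1 M - term_of 1 N) \<in> J"
        using J unfolding ideal_poly_ring_iff by blast
      then have gJ: "g \<in> J"
        by (simp add: g_def right_diff_distrib mult_single)
      \<comment> \<open>The other monomial \<open>N\<close> of \<open>g\<close> already lies in the
        support of \<open>f\<close>, so subtracting \<open>g\<close> deletes \<open>\<mu>\<close>
        and brings in nothing new.\<close>
      have keys: "Poly_Mapping.keys (f - g) \<subseteq> Poly_Mapping.keys f - {\<mu>}"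
        using N \<mu> M
        by (auto simp: in_keys_iff lookup_minus g_def lookup_single when_def c_def split: if_splits)
      have "toric_hom (f - g) = 0"
        using less.prems N(3) by (simp add: toric_ideal_iff toric_hom_diff g_def toric_hom_term_of)
      moreover have "f - g \<in> carrier (poly_ring ?X)"
        using keys car by (auto simp: poly_ring_simps)
      moreover have "card (Poly_Mapping.keys (f - g)) < card (Poly_Mapping.keys f)"
        using keys \<mu> by (intro psubset_card_mono) auto
      ultimately have "f - g \<in> J"
        using less.hyps by (simp add: toric_ideal_iff)
      with gJ have "f - g + g \<in> J"
        using J unfolding ideal_poly_ring_iff by blast
      then show ?thesis by simp
    qed
  qed
qed

text \<open>An ideal seen through its binomials. Connectivity is argued for such relations in
  general, so that it applies to every ideal containing the moves and also to relations pulled back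
  along a map of lattice points.\<close>

locale multiset_congruence =
  fixes X :: "'a set" and R :: "'a multiset \<Rightarrow> 'a multiset \<Rightarrow> bool" (infix "\<sim>" 50)
  assumes refl: "set_mset M \<subseteq> X \<Longrightarrow> M \<sim> M"
    and sym: "M \<sim> N \<Longrightarrow> N \<sim> M"
    and trans [trans]: "M \<sim> N \<Longrightarrow> N \<sim> K \<Longrightarrow> M \<sim> K"
    and add: "M \<sim> N \<Longrightarrow> set_mset K \<subseteq> X \<Longrightarrow> M + K \<sim> N + K"

text \<open>Symmetry is multiplication by \<open>- 1\<close>, transitivity a telescoping sum, and
  adding \<open>K\<close> is multiplication by the monomial of \<open>K\<close>.\<close>

lemma multiset_congruence_binomial_rel:
  assumes J: "ideal J (poly_ring X)"
  shows "multiset_congruence X (binomial_rel X J)"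
proof
  have mult: "g * f \<in> J" if "f \<in> J" "g \<in> carrier (poly_ring X)" for f g
    using J that by (auto simp: ideal_poly_ring_iff)
  have plus: "f + g \<in> J" if "f \<in> J" "g \<in> J" for f g
    using J that by (auto simp: ideal_poly_ring_iff)
  fix M N K
  show "binomial_rel X J M M" if "set_mset M \<subseteq> X"
    using J that by (auto simp: binomial_rel_def ideal_poly_ring_iff)
  show "binomial_rel X J N M" if "binomial_rel X J M N"
    using that mult[of "term_of 1 M - term_of 1 N" "- 1"]
    by (auto simp: binomial_rel_def poly_ring_simps)
  show "binomial_rel X J M K" if "binomial_rel X J M N" "binomial_rel X J N K"
    using that plus[of "term_of 1 M - term_of 1 N" "term_of 1 N - term_of 1 K"]
    by (auto simp: binomial_rel_def)
  show "binomial_rel X J (M + K) (N + K)" if "binomial_rel X J M N" "set_mset K \<subseteq> X"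
    using that mult[of "term_of 1 M - term_of 1 N" "term_of 1 K"] term_of_in_carrier[of K X 1]
    by (auto simp: binomial_rel_def right_diff_distrib mult_single add.commute)
qed

text \<open>The generated ideal is the intersection of all ideals containing \<open>G\<close>, so it
  suffices to compare with each of them.\<close>

lemma toric_ideal_generated_byI:
  assumes "G \<subseteq> toric_ideal P"
    and "\<And>J. ideal J (poly_ring (lattice_points P)) \<Longrightarrow> G \<subseteq> J \<Longrightarrow> toric_ideal P \<subseteq> J"
  shows "toric_ideal_generated_by P G"
  using assms ideal_toric_ideal[of P]
  by (auto simp: toric_ideal_generated_by_def genideal_def toric_ideal_iff)

lemma binomial_in_toric_ideal:
  assumes "set_mset M \<subseteq> lattice_points P" "set_mset N \<subseteq> lattice_points P"
    and "size M = size N" "\<Sum>\<^sub># M = \<Sum>\<^sub># N"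
  shows "term_of 1 M - term_of 1 N \<in> toric_ideal P"
proof -
  have "term_of 1 M - term_of 1 N \<in> carrier (poly_ring (lattice_points P))"
    using assms(1,2) keys_diff[of "term_of 1 M" "term_of 1 N"]
    by (fastforce simp: poly_ring_simps keys_monom_of)
  with assms(3,4) show ?thesis
    by (simp add: toric_ideal_iff toric_hom_diff toric_hom_term_of weight_of_eq)
qed

text \<open>An ideal containing all elements of degree at most two of the toric ideal induces a
  congruence that contains all quadratic moves. If such congruences connect all factorizations,
  \<open>toric_ideal_le\<close> applies.\<close>

lemma generated_in_degree_twoI:
  assumes "\<And>R M N. multiset_congruence (lattice_points P) R \<Longrightarrow>
     (\<And>p q p' q'. {p, q, p', q'} \<subseteq> lattice_points P \<Longrightarrow> p + q = p' + q' \<Longrightarrow> R {#p, q#} {#p', q'#}) \<Longrightarrow>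
     set_mset M \<subseteq> lattice_points P \<Longrightarrow> set_mset N \<subseteq> lattice_points P \<Longrightarrow>
     size M = size N \<Longrightarrow> \<Sum>\<^sub># M = \<Sum>\<^sub># N \<Longrightarrow> R M N"
  shows "generated_in_degree_two P"
  unfolding generated_in_degree_two_def
proof (intro exI conjI)
  let ?G = "{g \<in> toric_ideal P. degree_at_most 2 g}"
  show "toric_ideal_generated_by P ?G"
  proof (rule toric_ideal_generated_byI)
    fix J
    assume J: "ideal J (poly_ring (lattice_points P))" "?G \<subseteq> J"
    show "toric_ideal P \<subseteq> J"
    proof (rule toric_ideal_le[OF J(1)], rule assms[OF multiset_congruence_binomial_rel[OF J(1)]])
      fix p q p' q' :: "int ^ 'a"
      assume pq: "{p, q, p', q'} \<subseteq> lattice_points P" "p + q = p' + q'"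
      have "degree_at_most 2 (term_of 1 {#p, q#} - term_of 1 {#p', q'#})"
        using keys_diff[of "term_of 1 {#p, q#}" "term_of 1 {#p', q'#}"]
          monom_degree_monom_of[of "{#p, q#}"] monom_degree_monom_of[of "{#p', q'#}"]
        by (fastforce simp: degree_at_most_def)
      with pq J(2) binomial_in_toric_ideal[of "{#p, q#}" P "{#p', q'#}"]
      show "binomial_rel (lattice_points P) J {#p, q#} {#p', q'#}"
        by (auto simp: binomial_rel_def)
    qed
  qed auto
qed auto

section \<open>Integral flows\<close>

text \<open>The coefficient type is left open because rounding compares real flows with integral
  ones.\<close>

definition net_flow :: "('v, 'e::finite) pre_digraph \<Rightarrow> 'a::ab_group_add ^ 'e \<Rightarrow> 'v \<Rightarrow> 'a" where
  "net_flow Q x v = (\<Sum>a\<in>in_arcs Q v. x $ a) - (\<Sum>a\<in>out_arcs Q v. x $ a)"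

lemma net_flow_zero: "net_flow Q 0 v = 0"
  by (simp add: net_flow_def)

lemma net_flow_add: "net_flow Q (x + y) v = net_flow Q x v + net_flow Q y v"
  by (simp add: net_flow_def sum.distrib)

lemma net_flow_diff: "net_flow Q (x - y) v = net_flow Q x v - net_flow Q y v"
  by (simp add: net_flow_def sum_subtractf)

lemma net_flow_scaleR: "net_flow Q (c *\<^sub>R x) v = c * net_flow Q x v"
  for x :: "real ^ 'e::finite"
  by (simp add: net_flow_def sum_distrib_left right_diff_distrib)

lemma net_flow_real_vec: "net_flow Q (real_vec m) v = of_int (net_flow Q m v)"
  by (simp add: net_flow_def real_vec_def)

lemma real_vec_nth: "real_vec m $ i = of_int (m $ i)"
  by (simp add: real_vec_def)

lemma sum_mset_real_vec: "(\<Sum>m\<in>#M. real_vec (g m)) = real_vec (\<Sum>m\<in>#M. g m)"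
  by (induction M) (simp_all add: vec_eq_iff real_vec_def)

lemma real_vec_inject: "real_vec m = real_vec n \<longleftrightarrow> m = n"
  by (auto simp: vec_eq_iff real_vec_def)

locale weighted_quiver = fin_digraph Q
  for Q :: "('v, 'e::finite) pre_digraph" +
  fixes \<theta> :: "'v \<Rightarrow> int"
begin

lemma net_flow_alt:
  fixes x :: "'a::ab_group_add ^ 'e"
  shows "net_flow Q x v =
    (\<Sum>a\<in>arcs Q. (if head Q a = v then x $ a else 0) - (if tail Q a = v then x $ a else 0))"
  by (simp add: net_flow_def in_arcs_def out_arcs_def sum_subtractf sum.inter_filter[symmetric])

text \<open>
  Every vertex touched by fractional arcs lies on at least two of them (loops aside), so there are
  at least as many such arcs as balance conditions on them; the latter sum to zero, which leaves a
  nonzero solution.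
\<close>

lemma exists_fractional_circulation:
  fixes x :: "real ^ 'e"
  assumes net: "\<And>v. v \<in> verts Q \<Longrightarrow> net_flow Q x v \<in> \<int>"
    and frac: "a0 \<in> arcs Q" "x $ a0 \<notin> \<int>"
  obtains z :: "real ^ 'e" where "z \<noteq> 0" "\<And>a. z $ a \<noteq> 0 \<Longrightarrow> a \<in> arcs Q \<and> x $ a \<notin> \<int>"
    "\<And>v. net_flow Q z v = 0"
proof -
  define F where "F = {a \<in> arcs Q. x $ a \<notin> \<int>}"
  have F: "finite F" "a0 \<in> F" "F \<subseteq> arcs Q"
    using frac by (auto simp: F_def)
  show thesis
  proof (cases "\<exists>a\<in>F. head Q a = tail Q a")
    case True
    then obtain a where a: "a \<in> F" "head Q a = tail Q a" by blast
    \<comment> \<open>A loop enters and leaves the same vertex, so its unit vector is a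
      circulation.\<close>
    show thesis
    proof (rule that[of "axis a 1"])
      show "net_flow Q (axis a 1 :: real ^ 'e) v = 0" for v
        using a(2) by (auto simp: net_flow_alt axis_def intro!: sum.neutral)
    qed (use a in \<open>auto simp: F_def axis_def vec_eq_iff split: if_splits\<close>)
  next
    case False
    define V where "V = head Q ` F \<union> tail Q ` F"
    have V: "finite V" "V \<subseteq> verts Q" "head Q a0 \<in> V"
      using F by (auto simp: V_def)
    \<comment> \<open>With a single fractional incidence at \<open>v\<close>, all other terms of the
      balance at \<open>v\<close> would be integers, and so would this one.\<close>
    have deg: "2 \<le> card {a \<in> F. head Q a = v} + card {a \<in> F. tail Q a = v}" if "v \<in> V" for v
    proof (rule ccontr)
      let ?I = "{a \<in> F. head Q a = v}" and ?O = "{a \<in> F. tail Q a = v}"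
      assume "\<not> 2 \<le> card ?I + card ?O"
      moreover have "?I \<noteq> {} \<or> ?O \<noteq> {}"
        using that by (auto simp: V_def)
      then have "card ?I \<noteq> 0 \<or> card ?O \<noteq> 0"
        using F(1) by auto
      ultimately have "card ?I = 1 \<and> card ?O = 0 \<or> card ?I = 0 \<and> card ?O = 1"
        by linarith
      then obtain a where a: "?I = {a} \<and> ?O = {} \<or> ?I = {} \<and> ?O = {a}"
        using F(1) by (auto simp: card_1_singleton_iff)
      then have aF: "a \<in> F" by blast
      have 1: "(\<Sum>b\<in>in_arcs Q v. x $ b) - (\<Sum>b\<in>?I. x $ b) \<in> \<int>"
      proof -
        have "(\<Sum>b\<in>in_arcs Q v. x $ b) - (\<Sum>b\<in>?I. x $ b) = (\<Sum>b\<in>in_arcs Q v - ?I. x $ b)"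
          by (subst sum_diff) (auto simp: F_def)
        also have "\<dots> \<in> \<int>"
          by (intro Ints_sum) (auto simp: F_def in_arcs_def)
        finally show ?thesis .
      qed
      have 2: "(\<Sum>b\<in>out_arcs Q v. x $ b) - (\<Sum>b\<in>?O. x $ b) \<in> \<int>"
      proof -
        have "(\<Sum>b\<in>out_arcs Q v. x $ b) - (\<Sum>b\<in>?O. x $ b) = (\<Sum>b\<in>out_arcs Q v - ?O. x $ b)"
          by (subst sum_diff) (auto simp: F_def)
        also have "\<dots> \<in> \<int>"
          by (intro Ints_sum) (auto simp: F_def out_arcs_def)
        finally show ?thesis .
      qed
      have "(\<Sum>b\<in>?I. x $ b) - (\<Sum>b\<in>?O. x $ b) \<in> \<int>"
        using Ints_diff[OF net Ints_diff[OF 1 2], of v] \<open>v \<in> V\<close> V(2)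
        by (auto simp: net_flow_def algebra_simps)
      moreover have "(\<Sum>b\<in>?I. x $ b) - (\<Sum>b\<in>?O. x $ b) \<in> {x $ a, - x $ a}"
        using a by (elim disjE conjE) (simp_all only:, simp_all)
      ultimately have "x $ a \<in> \<int>"
        by auto
      then show False
        using aF by (simp add: F_def)
    qed
    have "2 * card V = (\<Sum>v\<in>V. 2)"
      by simp
    also have "\<dots> \<le> (\<Sum>v\<in>V. card {a \<in> F. head Q a = v} + card {a \<in> F. tail Q a = v})"
      by (rule sum_mono) (rule deg)
    \<comment> \<open>Double counting: every arc of \<open>F\<close> has one head and one tail, both
      in \<open>V\<close>.\<close>
    also have "\<dots> = 2 * card F"
    proof -
      have "(\<Sum>v\<in>V. card {a \<in> F. h a = v}) = card F" if "h ` F \<subseteq> V" for h :: "'e \<Rightarrow> 'v"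
        using sum.group[OF F(1) V(1) that, of "\<lambda>_. 1 :: nat"] by simp
      from this[of "head Q"] this[of "tail Q"] show ?thesis
        by (simp add: sum.distrib V_def)
    qed
    finally have card: "card V \<le> card F" by simp
    \<comment> \<open>\<open>b v\<close> is the balance condition at \<open>v\<close> restricted to
      \<open>F\<close>: for \<open>z\<close> supported on \<open>F\<close>, its inner product with
      \<open>b v\<close> is \<open>net_flow Q z v\<close>.\<close>
    define b :: "'v \<Rightarrow> real ^ 'e" where
      "b v = (\<chi> a. if a \<in> F then of_bool (head Q a = v) - of_bool (tail Q a = v) else 0)" for v
    define W where "W = V - {head Q a0}"
    have "(\<Sum>v\<in>V. b v $ a) = 0" for a
    proof (cases "a \<in> F")
      case True
      then have "head Q a \<in> V" "tail Q a \<in> V" by (auto simp: V_def)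
      then show ?thesis
        using V(1) True by (simp add: b_def sum_subtractf of_bool_def)
    qed (simp add: b_def)
    then have sum_b: "(\<Sum>v\<in>V. b v) = 0"
      by (simp add: vec_eq_iff)
    have bV: "b v \<in> span (b ` W)" if "v \<in> V" for v
    proof (cases "v = head Q a0")
      case True
      have "b v = - (\<Sum>w\<in>W. b w)"
        using sum_b V by (simp add: W_def True sum_diff1)
      then show ?thesis
        by (simp only:) (intro span_neg span_sum span_base imageI)
    qed (use that in \<open>auto simp: W_def intro!: span_base\<close>)
    let ?A = "(\<lambda>a. axis a (1::real)) ` F"
    have expand: "w \<in> span ?A" if "\<And>a. a \<notin> F \<Longrightarrow> w $ a = 0" for w :: "real ^ 'e"
    proof -
      have "w = (\<Sum>a\<in>F. (w $ a) *\<^sub>R axis a 1)"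
        using F(1) that by (auto simp: vec_eq_iff axis_def if_distrib[of "\<lambda>x. _ * x"] cong: if_cong)
      then show ?thesis
        by (metis (mono_tags, lifting) image_eqI span_base span_scale span_sum)
    qed
    have "independent ?A"
      by (rule independent_mono[OF independent_Basis]) (auto simp: axis_in_Basis_iff)
    moreover have "card ?A = card F"
      by (rule card_image) (auto simp: inj_on_def axis_eq_axis)
    ultimately have dimA: "dim (span ?A) = card F"
      by (simp add: dim_eq_card_independent)
    have "dim (span (b ` W)) \<le> card W"
      using dim_le_card'[of "b ` W"] card_image_le[of W b] V(1) by (simp add: W_def)
    also have "card W < card V"
      by (rule psubset_card_mono) (use V in \<open>auto simp: W_def\<close>)
    finally have "dim (span (b ` W)) < card F"
      using card by linarith
    then have "span (b ` W) \<noteq> span ?A"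
      using dimA by (metis order_less_irrefl)
    moreover have "span (b ` W) \<subseteq> span ?A"
      by (rule span_minimal) (auto simp: b_def intro!: expand)
    \<comment> \<open>A proper subspace of the coordinate space of \<open>F\<close> leaves a nonzero
      vector of that space orthogonal to it; this is the circulation.\<close>
    ultimately obtain z where z: "z \<noteq> 0" "z \<in> span ?A" "\<And>y. y \<in> span (b ` W) \<Longrightarrow> orthogonal z y"
      using orthogonal_to_subspace_exists_gen[of "b ` W" ?A] by auto
    have supp: "z $ a = 0" if "a \<notin> F" for a
    proof -
      have "subspace {y :: real ^ 'e. y $ a = 0}"
        by (auto simp: subspace_def)
      then have "span ?A \<subseteq> {y. y $ a = 0}"
        using that by (intro span_minimal) (auto simp: axis_def)
      with z(2) show ?thesis by auto
    qed
    have "net_flow Q z v = 0" for v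
    proof -
      have "net_flow Q z v = (\<Sum>a\<in>arcs Q. z $ a * b v $ a)"
        by (simp add: net_flow_alt) (rule sum.cong, auto simp: b_def supp)
      also have "\<dots> = z \<bullet> b v"
        unfolding inner_vec_def
        by (rule sum.mono_neutral_cong_left) (use F(3) in \<open>auto simp: b_def\<close>)
      also have "\<dots> = 0"
      proof (cases "v \<in> V")
        case True
        then show ?thesis using z(3)[OF bV] by (simp add: orthogonal_def)
      next
        case False
        then have "b v = 0" by (auto simp: vec_eq_iff b_def V_def)
        then show ?thesis by simp
      qed
      finally show ?thesis .
    qed
    then show thesis
      using that[OF z(1)] supp by (auto simp: F_def)
  qed
qed

section \<open>Rounding and decomposing flows\<close>

text \<open>Adding a multiple of a circulation supported on fractional arcs keeps all balances.
  Going on until the first arc becomes integral lowers the number of fractional arcs, and no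
  coordinate passes its floor or ceiling.\<close>

lemma flow_rounding:
  fixes x :: "real ^ 'e"
  assumes "\<And>v. v \<in> verts Q \<Longrightarrow> net_flow Q x v \<in> \<int>"
  obtains y :: "int ^ 'e" where "\<And>a. \<lfloor>x $ a\<rfloor> \<le> y $ a" "\<And>a. y $ a \<le> \<lceil>x $ a\<rceil>"
    "\<And>v. v \<in> verts Q \<Longrightarrow> of_int (net_flow Q y v) = net_flow Q x v"
proof -
  have "\<exists>y :: int ^ 'e. (\<forall>a. \<lfloor>x $ a\<rfloor> \<le> y $ a \<and> y $ a \<le> \<lceil>x $ a\<rceil>) \<and>
    (\<forall>v\<in>verts Q. of_int (net_flow Q y v) = net_flow Q x v)"
    using assms
  proof (induction "card {a \<in> arcs Q. x $ a \<notin> \<int>}" arbitrary: x rule: less_induct)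
    case less
    show ?case
    proof (cases "\<exists>a\<in>arcs Q. x $ a \<notin> \<int>")
      case False
      then have "real_of_int \<lfloor>x $ a\<rfloor> = x $ a" if "a \<in> arcs Q" for a
        using that by (simp add: of_int_floor)
      then have "(\<Sum>a\<in>A. real_of_int \<lfloor>x $ a\<rfloor>) = (\<Sum>a\<in>A. x $ a)" if "A \<subseteq> arcs Q" for A
        using that by (intro sum.cong) auto
      \<comment> \<open>Coordinates outside \<open>arcs Q\<close> may be fractional; flooring them
        is harmless because the net flow does not see them.\<close>
      then have "real_of_int (net_flow Q (\<chi> a. \<lfloor>x $ a\<rfloor>) v) = net_flow Q x v" for v
        by (simp add: net_flow_def in_arcs_def out_arcs_def)
      then show ?thesis
        by (intro exI[of _ "\<chi> a. \<lfloor>x $ a\<rfloor>"]) auto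
    next
      case True
      then obtain a0 where a0: "a0 \<in> arcs Q" "x $ a0 \<notin> \<int>" by blast
      obtain z :: "real ^ 'e" where z: "z \<noteq> 0"
        "\<And>a. z $ a \<noteq> 0 \<Longrightarrow> a \<in> arcs Q \<and> x $ a \<notin> \<int>" "\<And>v. net_flow Q z v = 0"
        by (rule exists_fractional_circulation[OF less.prems a0]) blast+
      \<comment> \<open>\<open>D a\<close> is the step length at which coordinate \<open>a\<close>
        reaches the next integer in the direction of \<open>z\<close>; the smallest such length is
        taken below.\<close>
      define D where "D a = ((if z $ a > 0 then \<lceil>x $ a\<rceil> else \<lfloor>x $ a\<rfloor>) - x $ a) / z $ a" for a
      define Z where "Z = {a. z $ a \<noteq> 0}"
      have Z: "finite Z" "Z \<noteq> {}"
        using z(1) by (auto simp: Z_def vec_eq_iff)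
      define t where "t = Min (D ` Z)"
      have "t \<in> D ` Z"
        unfolding t_def using Z by (intro Min_in) auto
      then obtain a1 where a1: "a1 \<in> Z" "t = D a1"
        by blast
      have t_le: "t \<le> D a" if "a \<in> Z" for a
        using that Z(1) by (simp add: t_def)
      have frac: "of_int \<lfloor>x $ a\<rfloor> < x $ a \<and> x $ a < of_int \<lceil>x $ a\<rceil>" if "a \<in> Z" for a
        using that z(2)[of a] unfolding Z_def
        by (smt (verit, best) Ints_of_int ceiling_correct floor_correct mem_Collect_eq)
      have "D a > 0" if "a \<in> Z" for a
        using frac[OF that] that by (auto simp: D_def Z_def zero_less_divide_iff)
      then have t_pos: "t > 0"
        using a1 by simp
      define x' where "x' = x + t *\<^sub>R z"
      have x'_int: "x' $ a1 \<in> \<int>"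
        using a1 by (simp add: x'_def D_def Z_def)
      have x'_eq: "x' $ a = x $ a" if "a \<notin> Z" for a
        using that by (simp add: x'_def Z_def)
      have x'_box: "of_int \<lfloor>x $ a\<rfloor> \<le> x' $ a \<and> x' $ a \<le> of_int \<lceil>x $ a\<rceil>" for a
      proof (cases "a \<in> Z")
        case True
        consider "z $ a > 0" | "z $ a < 0"
          using True by (force simp: Z_def)
        then show ?thesis
        proof cases
          case 1
          have "t * z $ a \<le> of_int \<lceil>x $ a\<rceil> - x $ a"
            using t_le[OF True] 1 by (simp add: D_def pos_le_divide_eq)
          moreover have "t * z $ a > 0"
            using 1 t_pos by simp
          ultimately show ?thesis
            using frac[OF True] by (simp add: x'_def)
        next
          case 2
          have "t * z $ a \<ge> of_int \<lfloor>x $ a\<rfloor> - x $ a"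
            using t_le[OF True] 2 by (simp add: D_def neg_le_divide_eq)
          moreover have "t * z $ a < 0"
            using 2 t_pos by (simp add: mult_less_0_iff)
          ultimately show ?thesis
            using frac[OF True] by (simp add: x'_def)
        qed
      qed (simp add: x'_eq)
      have net': "net_flow Q x' v = net_flow Q x v" for v
        by (simp add: x'_def net_flow_add net_flow_scaleR z(3))
      \<comment> \<open>Only fractional arcs are moved, so no new fractional arc appears, while
        \<open>a1\<close> has become integral.\<close>
      have "{a \<in> arcs Q. x' $ a \<notin> \<int>} \<subseteq> {a \<in> arcs Q. x $ a \<notin> \<int>} - {a1}"
        using x'_int x'_eq z(2) by (auto simp: Z_def) metis
      moreover have "a1 \<in> {a \<in> arcs Q. x $ a \<notin> \<int>}"
        using a1 z(2) by (auto simp: Z_def)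
      ultimately have "card {a \<in> arcs Q. x' $ a \<notin> \<int>} < card {a \<in> arcs Q. x $ a \<notin> \<int>}"
        by (intro psubset_card_mono) auto
      then have "\<exists>y :: int ^ 'e. (\<forall>a. \<lfloor>x' $ a\<rfloor> \<le> y $ a \<and> y $ a \<le> \<lceil>x' $ a\<rceil>) \<and>
          (\<forall>v\<in>verts Q. of_int (net_flow Q y v) = net_flow Q x' v)"
        by (rule less.hyps) (use less.prems net' in auto)
      then obtain y :: "int ^ 'e" where y: "\<And>a. \<lfloor>x' $ a\<rfloor> \<le> y $ a \<and> y $ a \<le> \<lceil>x' $ a\<rceil>"
        "\<And>v. v \<in> verts Q \<Longrightarrow> of_int (net_flow Q y v) = net_flow Q x' v"
        by blast
      have "\<lfloor>x $ a\<rfloor> \<le> y $ a \<and> y $ a \<le> \<lceil>x $ a\<rceil>" for a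
        using x'_box[of a] y(1)[of a] by (meson ceiling_le_iff le_floor_iff order_trans)
      then show ?thesis
        using y(2) net' by auto
    qed
  qed
  then show thesis
    using that by blast
qed

definition is_flow :: "int ^ 'e \<Rightarrow> bool" where
  "is_flow m \<longleftrightarrow> (\<forall>v\<in>verts Q. net_flow Q m v = \<theta> v)"

text \<open>Rounding the average of \<open>S\<close> splits off one flow inside the box; the
  rounding bounds keep the remainder within the box scaled by one less, and induction
  continues.\<close>

lemma flow_decomposition:
  fixes S lo hi :: "int ^ 'e"
  assumes "\<And>v. v \<in> verts Q \<Longrightarrow> net_flow Q S v = int k * \<theta> v"
    and "\<And>a. int k * lo $ a \<le> S $ a" "\<And>a. S $ a \<le> int k * hi $ a"
  obtains M where "size M = k" "\<Sum>\<^sub># M = S"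
    "\<And>m. m \<in># M \<Longrightarrow> is_flow m \<and> (\<forall>a. lo $ a \<le> m $ a \<and> m $ a \<le> hi $ a)"
proof -
  have "\<exists>M. size M = k \<and> \<Sum>\<^sub># M = S \<and>
    (\<forall>m\<in>#M. is_flow m \<and> (\<forall>a. lo $ a \<le> m $ a \<and> m $ a \<le> hi $ a))"
    using assms
  proof (induction k arbitrary: S)
    case 0
    then have "S = 0"
      by (simp add: vec_eq_iff order_antisym)
    then show ?case
      by (intro exI[of _ "{#}"]) simp
  next
    case (Suc k)
    define K where "K = real (Suc k)"
    have K: "K > 0" "K = real k + 1" by (auto simp: K_def)
    define x where "x = (1 / K) *\<^sub>R real_vec S"
    have x: "x $ a = S $ a / K" for a
      by (simp add: x_def real_vec_def)
    have net: "net_flow Q x v = \<theta> v" if "v \<in> verts Q" for v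
    proof -
      have "of_int (net_flow Q S v) = K * \<theta> v"
        using Suc.prems(1)[OF that] by (simp add: K_def)
      then show ?thesis
        using K(1) by (simp add: x_def net_flow_scaleR net_flow_real_vec)
    qed
    obtain y :: "int ^ 'e" where y: "\<And>a. \<lfloor>x $ a\<rfloor> \<le> y $ a" "\<And>a. y $ a \<le> \<lceil>x $ a\<rceil>"
      "\<And>v. v \<in> verts Q \<Longrightarrow> of_int (net_flow Q y v) = net_flow Q x v"
      by (rule flow_rounding[of x]) (auto simp: net)
    have yflow: "is_flow y"
      using y(3) net by (auto simp: is_flow_def)
    have lo: "K * lo $ a \<le> S $ a" and hi: "S $ a \<le> K * hi $ a" for a
      using Suc.prems(2,3)[of a] unfolding K_def
      by (metis of_int_le_iff of_int_mult of_int_of_nat_eq)+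
    have ybox: "lo $ a \<le> y $ a \<and> y $ a \<le> hi $ a" for a
    proof -
      have "lo $ a \<le> \<lfloor>x $ a\<rfloor>" "\<lceil>x $ a\<rceil> \<le> hi $ a"
        using lo[of a] hi[of a] K(1) by (auto simp: x le_floor_iff ceiling_le_iff field_simps)
      with y(1,2)[of a] show ?thesis by linarith
    qed
    \<comment> \<open>Multiplying \<open>K * lo \<le> S\<close> by \<open>k / K\<close> and
      rearranging gives \<open>S / K \<le> S - k * lo\<close>. The right side is an integer, so it
      also bounds the ceiling and hence \<open>y\<close>; the upper bound is symmetric.\<close>
    have rest: "int k * lo $ a \<le> (S - y) $ a \<and> (S - y) $ a \<le> int k * hi $ a" for a
    proof -
      have "real k * (K * lo $ a) \<le> real k * S $ a" "real k * S $ a \<le> real k * (K * hi $ a)"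
        using lo[of a] hi[of a] by (intro mult_left_mono; simp)+
      then have "S $ a / K \<le> of_int (S $ a - int k * lo $ a)"
        "of_int (S $ a - int k * hi $ a) \<le> S $ a / K"
        using K by (auto simp: field_simps)
      then have "\<lceil>x $ a\<rceil> \<le> S $ a - int k * lo $ a" "S $ a - int k * hi $ a \<le> \<lfloor>x $ a\<rfloor>"
        by (simp_all only: x ceiling_le_iff le_floor_iff)
      with y(1,2)[of a] show ?thesis by simp
    qed
    obtain M where "size M = k" "\<Sum>\<^sub># M = S - y"
      "\<forall>m\<in>#M. is_flow m \<and> (\<forall>a. lo $ a \<le> m $ a \<and> m $ a \<le> hi $ a)"
      using Suc.IH[of "S - y"] Suc.prems(1) yflow rest
      by (auto simp: net_flow_diff is_flow_def algebra_simps)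
    then show ?case
      using yflow ybox by (intro exI[of _ "add_mset y M"]) auto
  qed
  then show thesis
    using that by blast
qed

abbreviation (input) P where "P \<equiv> quiver_polytope Q \<theta>"

lemma lattice_points_iff:
  "m \<in> lattice_points P \<longleftrightarrow>
    is_flow m \<and> (\<forall>a\<in>arcs Q. 0 \<le> m $ a) \<and> (\<forall>a. a \<notin> arcs Q \<longrightarrow> m $ a = 0)"
proof -
  have "real_of_int (\<theta> v) = (\<Sum>a\<in>in_arcs Q v. real_vec m $ a) - (\<Sum>a\<in>out_arcs Q v. real_vec m $ a)
      \<longleftrightarrow> net_flow Q m v = \<theta> v" for v
    using net_flow_real_vec[of Q m v] by (auto simp: net_flow_def[of Q "real_vec m"])
  then show ?thesis
    by (auto simp: lattice_points_def quiver_polytope_def is_flow_def real_vec_def)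
qed

lemma convex_quiver_polytope: "convex P"
proof -
  have "P = (\<Inter>a\<in>arcs Q. {x. 0 \<le> x $ a}) \<inter> (\<Inter>a\<in>- arcs Q. {x. x $ a = 0}) \<inter>
      (\<Inter>v\<in>verts Q. {x. net_flow Q x v = \<theta> v})"
    by (auto simp: quiver_polytope_def net_flow_def)
  moreover have "convex {x :: real ^ 'e. 0 \<le> x $ a}" "convex {x :: real ^ 'e. x $ a = 0}" for a
    by (auto simp: convex_def)
  moreover have "convex {x :: real ^ 'e. net_flow Q x v = \<theta> v}" for v
    by (auto simp: convex_def net_flow_add net_flow_scaleR simp flip: distrib_right)
  ultimately show ?thesis
    by (auto intro!: convex_Int convex_INT)
qed

end

section \<open>Obstructions to quadratic moves\<close>

text \<open>An affine function of one coordinate, stored as data so that the same function can be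
  evaluated at integer and at real points.\<close>

fun coord_fun :: "int \<times> 'e \<times> int \<Rightarrow> 'a::ring_1 ^ 'e \<Rightarrow> 'a" where
  "coord_fun (s, a, c) x = of_int s * x $ a + of_int c"

lemma coord_fun_eq: "coord_fun t x = of_int (fst t) * x $ fst (snd t) + of_int (snd (snd t))"
  by (cases t) simp

lemma coord_fun_real_vec: "coord_fun t (real_vec m) = of_int (coord_fun t m)"
  by (cases t) (simp add: real_vec_def)

lemma coord_fun_affine:
  fixes g :: "'i \<Rightarrow> real ^ 'e"
  shows "(\<Sum>i\<in>I. u i * coord_fun (s, a, c) (g i)) = s * (\<Sum>i\<in>I. u i *\<^sub>R g i) $ a + c * (\<Sum>i\<in>I. u i)"
  by (simp add: distrib_left sum.distrib sum_distrib_left mult_ac)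

lemma sum_coord_fun_cong:
  assumes "size M = size N" "\<Sum>\<^sub># M = \<Sum>\<^sub># N"
  shows "(\<Sum>m\<in>#M. coord_fun t m) = (\<Sum>m\<in>#N. coord_fun t m :: int)"
proof -
  have "(\<Sum>m\<in>#K. coord_fun t m) = fst t * (\<Sum>\<^sub># K) $ fst (snd t) + int (size K) * snd (snd t)" for K
    by (induction K) (auto simp: coord_fun_eq algebra_simps)
  with assms show ?thesis by simp
qed

text \<open>Applied to an affine relation, \<open>t i j\<close> shows that the coefficients of
  \<open>y i\<close> and \<open>z j\<close> add up to zero. With the last \<open>z\<close> left out
  all coefficients vanish, so \<open>2 * k - 1\<close> of the points are affinely
  independent.\<close>

lemma aff_dim_ge_crossing:
  fixes y z :: "nat \<Rightarrow> int ^ 'e::finite"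
  assumes P: "\<And>i. i < k \<Longrightarrow> real_vec (y i) \<in> P \<and> real_vec (z i) \<in> P"
    and cross: "\<And>i j l. i < k \<Longrightarrow> j < k \<Longrightarrow> l < k \<Longrightarrow>
      coord_fun (t i j) (y l) = of_bool (l = i) \<and> coord_fun (t i j) (z l) = of_bool (l = j)"
    and "0 < k"
  shows "2 * int k - 2 \<le> aff_dim P"
proof -
  \<comment> \<open>This drops \<open>z (k - 1)\<close>: all \<open>2 * k\<close> points together
    may be dependent, for instance when both families have the same sum.\<close>
  define n where "n = 2 * k - 1"
  define g where "g l = (if l < k then real_vec (y l) else real_vec (z (l - k)))" for l
  have key: "\<forall>l<n. u l = 0" if "(\<Sum>l<n. u l) = 0" "(\<Sum>l<n. u l *\<^sub>R g l) = 0" for u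
  proof -
    have pair: "u i + (if k + j < n then u (k + j) else 0) = 0" if ij: "i < k" "j < k" for i j
    proof -
      obtain s a c where t: "t i j = (s, a, c)" by (cases "t i j")
      have "i < n"
        using ij \<open>0 < k\<close> by (simp add: n_def)
      have "coord_fun (t i j) (g l) = of_bool (l = i) + of_bool (l = k + j)" if "l < n" for l
        using that cross[OF ij, of l] cross[OF ij, of "l - k"] ij
        by (auto simp: g_def coord_fun_real_vec n_def of_bool_def)
      then have "(\<Sum>l<n. u l * coord_fun (t i j) (g l)) = (\<Sum>l<n. u l * (of_bool (l = i) + of_bool (l = k + j)))"
        by (intro sum.cong) auto
      also have "\<dots> = u i + (if k + j < n then u (k + j) else 0)"
        using \<open>i < n\<close>
        by (simp add: distrib_left sum.distrib of_bool_def if_distrib[of "\<lambda>x. _ * x"] cong: if_cong)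
      finally show ?thesis
        using that by (simp only: t coord_fun_affine \<open>(\<Sum>l<n. u l) = 0\<close> \<open>(\<Sum>l<n. u l *\<^sub>R g l) = 0\<close>) simp
    qed
    \<comment> \<open>The index \<open>k + (k - 1)\<close> is the omitted point, whose coefficient
      counts as zero, so \<open>pair\<close> isolates \<open>u i\<close>.\<close>
    have y0: "u i = 0" if "i < k" for i
    proof -
      have "\<not> k + (k - 1) < n"
        by (simp add: n_def)
      then show ?thesis
        using pair[OF that, of "k - 1"] \<open>0 < k\<close> by simp
    qed
    show ?thesis
    proof (intro allI impI)
      fix l assume "l < n"
      then show "u l = 0"
        using y0[of l] pair[of 0 "l - k"] y0[of 0] \<open>0 < k\<close> by (cases "l < k") (auto simp: n_def)
    qed
  qed
  have inj: "inj_on g {..<n}"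
  proof (rule inj_onI, rule ccontr)
    fix p q assume pq: "p \<in> {..<n}" "q \<in> {..<n}" "g p = g q" "p \<noteq> q"
    have "(\<Sum>l<n. (of_bool (l = p) - of_bool (l = q)) *\<^sub>R g l) = 0"
      using pq by (simp add: scaleR_diff_left sum_subtractf of_bool_def if_distrib[of "\<lambda>x. x *\<^sub>R _"] cong: if_cong)
    moreover have "(\<Sum>l<n. of_bool (l = p) - of_bool (l = q) :: real) = 0"
      using pq by (simp add: sum_subtractf of_bool_def)
    ultimately have "\<forall>l<n. of_bool (l = p) - of_bool (l = q) = (0 :: real)"
      using key by blast
    from this[rule_format, of p] pq show False by simp
  qed
  have "\<not> affine_dependent (g ` {..<n})"
  proof
    assume "affine_dependent (g ` {..<n})"
    then obtain U v where U: "sum U (g ` {..<n}) = 0" "v \<in> g ` {..<n}" "U v \<noteq> 0"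
      "(\<Sum>v\<in>g ` {..<n}. U v *\<^sub>R v) = 0"
      unfolding affine_dependent_explicit_finite[OF finite_imageI[OF finite_lessThan]] by blast
    have "\<forall>l<n. U (g l) = 0"
    proof (rule key)
      show "(\<Sum>l<n. U (g l)) = 0"
        using U(1) by (simp only: sum.reindex[OF inj] o_def)
      show "(\<Sum>l<n. U (g l) *\<^sub>R g l) = 0"
        using U(4) by (simp only: sum.reindex[OF inj] o_def)
    qed
    with U(2,3) show False by blast
  qed
  then have "aff_dim (g ` {..<n}) = int n - 1"
    using aff_dim_affine_independent[of "g ` {..<n}"] by (simp add: card_image[OF inj])
  moreover have "g ` {..<n} \<subseteq> P"
    using P by (auto simp: g_def n_def)
  ultimately show ?thesis
    using aff_dim_subset[of "g ` {..<n}" P] \<open>0 < k\<close> by (simp add: n_def)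
qed

lemma size_2_mset:
  assumes "size M = 2"
  obtains p q where "M = {#p, q#}"
proof -
  obtain p K where "M = add_mset p K"
    using assms by (cases M) auto
  moreover from this assms obtain q where "K = {#q#}"
    by (metis One_nat_def Suc_1 nat.inject size_1_singleton_mset size_add_mset)
  ultimately show thesis
    using that by blast
qed

section \<open>Balancing factorizations and blocking coordinates\<close>

text \<open>Termination measure of balancing: it drops at each move that closes a gap of two or
  more.\<close>

definition energy :: "(int ^ 'e) multiset \<Rightarrow> int" where
  "energy M = (\<Sum>m\<in>#M. \<Sum>a\<in>UNIV. (m $ a)\<^sup>2)"

lemma energy_nonneg: "0 \<le> energy M"
  by (induction M) (auto simp: energy_def intro!: add_nonneg_nonneg sum_nonneg)

text \<open>For a fixed sum, twice the sum of squares is a constant plus the squared difference, so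
  nearly equal summands minimize it.\<close>

lemma sum_squares_le:
  fixes p q p' q' :: int
  assumes "p' + q' = p + q" and "\<bar>p' - q'\<bar> \<le> 1"
  shows "p'\<^sup>2 + q'\<^sup>2 \<le> p\<^sup>2 + q\<^sup>2"
    and "\<not> \<bar>p - q\<bar> \<le> 1 \<Longrightarrow> p'\<^sup>2 + q'\<^sup>2 < p\<^sup>2 + q\<^sup>2"
proof -
  have "(p + q)\<^sup>2 = (p' + q')\<^sup>2" using assms by simp
  then have eq: "2 * (p\<^sup>2 + q\<^sup>2) - 2 * (p'\<^sup>2 + q'\<^sup>2) = (p - q)\<^sup>2 - (p' - q')\<^sup>2"
    by (simp add: power2_eq_square algebra_simps)
  \<comment> \<open>Equal sums give differences of equal parity, so a difference of absolute value
    at most one is the smallest possible.\<close>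
  have "\<bar>p' - q'\<bar> \<le> \<bar>p - q\<bar>"
    using assms by presburger
  then show "p'\<^sup>2 + q'\<^sup>2 \<le> p\<^sup>2 + q\<^sup>2"
    using eq by (simp add: abs_le_square_iff)
  show "p'\<^sup>2 + q'\<^sup>2 < p\<^sup>2 + q\<^sup>2" if "\<not> \<bar>p - q\<bar> \<le> 1"
  proof -
    have "\<not> (p - q)\<^sup>2 \<le> 1" "(p' - q')\<^sup>2 \<le> 1"
      using that assms(2) by (simp_all only: abs_square_le_1 not_False_eq_True)
    then have "0 < (p - q)\<^sup>2 - (p' - q')\<^sup>2"
      by (meson diff_gt_0_iff_gt le_less_trans not_le)
    then show ?thesis
      unfolding eq[symmetric] by simp
  qed
qed

lemma mset_conv_nth: "mset xs = image_mset ((!) xs) (mset_set {..<length xs})"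
  by (metis atLeast_upt map_nth mset_map mset_set_upto_eq_mset_upto)

text \<open>If a member were below \<open>l\<close>, the others, being within one of it, would be at
  most \<open>l\<close>, and the sum would fall short of \<open>size N * l\<close>; the upper bound
  is dual.\<close>

lemma balanced_in_box:
  fixes N :: "(int ^ 'e::finite) multiset"
  assumes bal: "\<And>p q. {#p, q#} \<subseteq># N \<Longrightarrow> \<bar>p $ a - q $ a\<bar> \<le> 1" and "m \<in># N"
  shows "int (size N) * l \<le> \<Sum>\<^sub># N $ a \<Longrightarrow> l \<le> m $ a"
    and "\<Sum>\<^sub># N $ a \<le> int (size N) * h \<Longrightarrow> m $ a \<le> h"
proof -
  obtain K where N: "N = add_mset m K"
    using \<open>m \<in># N\<close> by (metis multi_member_split)
  have near: "\<bar>m $ a - q $ a\<bar> \<le> 1" if "q \<in># K" for q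
    using bal[of m q] that by (simp add: N)
  have up: "\<Sum>\<^sub># K $ a \<le> int (size K) * (m $ a + 1)" if "\<forall>q\<in>#K. \<bar>m $ a - q $ a\<bar> \<le> 1" for K
    using that by (induction K) (auto simp: algebra_simps)
  have down: "int (size K) * (m $ a - 1) \<le> \<Sum>\<^sub># K $ a" if "\<forall>q\<in>#K. \<bar>m $ a - q $ a\<bar> \<le> 1" for K
    using that by (induction K) (auto simp: algebra_simps)
  show "l \<le> m $ a" if "int (size N) * l \<le> \<Sum>\<^sub># N $ a"
  proof (rule ccontr)
    assume "\<not> l \<le> m $ a"
    then have "int (size N) * (m $ a + 1) \<le> int (size N) * l"
      by (intro mult_left_mono) auto
    with that up[of K] near show False
      by (simp add: N algebra_simps)
  qed
  show "m $ a \<le> h" if "\<Sum>\<^sub># N $ a \<le> int (size N) * h"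
  proof (rule ccontr)
    assume "\<not> m $ a \<le> h"
    then have "int (size N) * h \<le> int (size N) * (m $ a - 1)"
      by (intro mult_left_mono) auto
    with that down[of K] near show False
      by (simp add: N algebra_simps)
  qed
qed

text \<open>The box has width at most one, so \<open>S - v - w\<close> can miss the box scaled by
  \<open>k - 2\<close> only if the total excess over \<open>lo\<close> is 1 while \<open>v\<close>
  and \<open>w\<close> both carry a unit, or dually below \<open>hi\<close>. This excess is a
  coordinate function of total 1 on every factorization.\<close>

lemma conflict_coord_fun:
  fixes S lo hi v w :: "int ^ 'e::finite"
  assumes "3 \<le> k"
    and S: "int k * lo $ a \<le> S $ a" "S $ a \<le> int k * hi $ a"
    and hi: "hi $ a \<le> lo $ a + 1" "S $ a = int k * lo $ a \<Longrightarrow> hi $ a = lo $ a" 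
       "S $ a = int k * hi $ a \<Longrightarrow> hi $ a = lo $ a"
    and v: "lo $ a \<le> v $ a" "v $ a \<le> hi $ a" and w: "lo $ a \<le> w $ a" "w $ a \<le> hi $ a"
    and conflict: "\<not> (int (k - 2) * lo $ a \<le> (S - v - w) $ a \<and> (S - v - w) $ a \<le> int (k - 2) * hi $ a)"
  obtains t where "coord_fun t v = 1" "coord_fun t w = 1"
    "\<And>m. lo $ a \<le> m $ a \<Longrightarrow> m $ a \<le> hi $ a \<Longrightarrow> 0 \<le> coord_fun t m"
    "\<And>M. size M = k \<Longrightarrow> \<Sum>\<^sub># M = S \<Longrightarrow> (\<Sum>m\<in>#M. coord_fun t m) = 1"
proof -
  have k: "int (k - 2) = int k - 2"
    using \<open>3 \<le> k\<close> by simp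
  have sum: "(\<Sum>m\<in>#M. m $ a - c) = (\<Sum>\<^sub># M) $ a - int (size M) * c"
    "(\<Sum>m\<in>#M. c - m $ a) = int (size M) * c - (\<Sum>\<^sub># M) $ a" for M and c :: int
    by (induction M) (auto simp: algebra_simps)
  consider (lo) "S $ a - v $ a - w $ a < (int k - 2) * lo $ a"
    | (hi) "(int k - 2) * hi $ a < S $ a - v $ a - w $ a"
    using conflict by (auto simp: k)
  then show thesis
  proof cases
    case lo
    then have "S $ a - int k * lo $ a < (v $ a - lo $ a) + (w $ a - lo $ a)"
      by (simp add: algebra_simps)
    \<comment> \<open>The excess is below 2 by the width of the box, and it is not 0, as then
      \<open>hi = lo\<close> at \<open>a\<close> and neither \<open>v\<close> nor \<open>w\<close>
      would carry a unit.\<close>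
    then have "S $ a - int k * lo $ a = 1" "v $ a = lo $ a + 1" "w $ a = lo $ a + 1"
      using S hi v w by linarith+
    then show thesis
      by (intro that[of "(1, a, - lo $ a)"]) (auto simp: sum)
  next
    case hi
    then have "int k * hi $ a - S $ a < (hi $ a - v $ a) + (hi $ a - w $ a)"
      by (simp add: algebra_simps)
    then have "int k * hi $ a - S $ a = 1" "v $ a = hi $ a - 1" "w $ a = hi $ a - 1"
      using S assms(4-6) v w by linarith+
    then show thesis
      by (intro that[of "(- 1, a, hi $ a)"]) (auto simp: sum)
  qed
qed

text \<open>Degree-two generation follows once every such congruence connects all factorizations of
  equal size and sum.\<close>

locale quadratic_congruence =
  weighted_quiver Q \<theta> + multiset_congruence "lattice_points (quiver_polytope Q \<theta>)" R
  for Q :: "('v, 'e::finite) pre_digraph" and \<theta> and R (infix "\<sim>" 50) +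
  assumes quadratic: "{p, q, p', q'} \<subseteq> lattice_points (quiver_polytope Q \<theta>) \<Longrightarrow>
    p + q = p' + q' \<Longrightarrow> {#p, q#} \<sim> {#p', q'#}"
begin

abbreviation (input) X where "X \<equiv> lattice_points P"

lemma net_flow_sum_mset:
  assumes "set_mset M \<subseteq> X" and "v \<in> verts Q"
  shows "net_flow Q (\<Sum>\<^sub># M) v = int (size M) * \<theta> v"
  using assms
  by (induction M) (auto simp: net_flow_zero net_flow_add lattice_points_iff is_flow_def algebra_simps)

text \<open>A pair with a gap of at least two is replaced by two flows between the floor and the
  ceiling of its half sum. This is one quadratic move, and it lowers the energy.\<close>

lemma exists_balanced:
  assumes "set_mset M \<subseteq> X"
  obtains N where "M \<sim> N" "set_mset N \<subseteq> X" "size N = size M" "\<Sum>\<^sub># N = \<Sum>\<^sub># M"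
    "\<And>p q a. {#p, q#} \<subseteq># N \<Longrightarrow> \<bar>p $ a - q $ a\<bar> \<le> 1"
proof -
  have "\<exists>N. M \<sim> N \<and> set_mset N \<subseteq> X \<and> size N = size M \<and> \<Sum>\<^sub># N = \<Sum>\<^sub># M \<and>
    (\<forall>p q a. {#p, q#} \<subseteq># N \<longrightarrow> \<bar>p $ a - q $ a\<bar> \<le> 1)"
    using assms
  proof (induction "nat (energy M)" arbitrary: M rule: less_induct)
    case less
    show ?case
    proof (cases "\<forall>p q a. {#p, q#} \<subseteq># M \<longrightarrow> \<bar>p $ a - q $ a\<bar> \<le> 1")
      case True
      then show ?thesis
        using less.prems refl by blast
    next
      case False
      then obtain p q a where pq: "{#p, q#} \<subseteq># M" "\<not> \<bar>p $ a - q $ a\<bar> \<le> 1"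
        by blast
      then obtain K where M: "M = {#p, q#} + K"
        by (metis mset_subset_eq_exists_conv)
      have pqX: "p \<in> X" "q \<in> X" and KX: "set_mset K \<subseteq> X"
        using less.prems M by auto
      define lo where "lo = (\<chi> a. (p $ a + q $ a) div 2)"
      define hi where "hi = (\<chi> a. (p $ a + q $ a + 1) div 2)"
      obtain D where D: "size D = 2" "\<Sum>\<^sub># D = p + q"
        "\<And>m. m \<in># D \<Longrightarrow> is_flow m \<and> (\<forall>a. lo $ a \<le> m $ a \<and> m $ a \<le> hi $ a)"
        by (rule flow_decomposition[of "p + q" 2 lo hi])
          (use pqX in \<open>auto simp: net_flow_add lattice_points_iff is_flow_def lo_def hi_def\<close>)
      then obtain p' q' where D': "D = {#p', q'#}"
        by (metis size_2_mset)
      have sum: "p' + q' = p + q"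
        using D(2) D' by simp
      have box: "is_flow m" "lo $ a \<le> m $ a" "m $ a \<le> hi $ a" if "m \<in> {p', q'}" for m a
        using D(3)[of m] D' that by auto
      have X': "p' \<in> X" "q' \<in> X"
      proof -
        have "m \<in> X" if "m \<in> {p', q'}" for m
          unfolding lattice_points_iff
        proof (intro conjI ballI allI impI)
          fix b
          show "0 \<le> m $ b" if "b \<in> arcs Q"
          proof -
            have "0 \<le> lo $ b"
              using that pqX by (simp add: lo_def lattice_points_iff)
            then show ?thesis using box(2)[OF \<open>m \<in> _\<close>, of b] by simp
          qed
          show "m $ b = 0" if "b \<notin> arcs Q"
            using that box(2,3)[OF \<open>m \<in> _\<close>, of b] pqX by (simp add: lo_def hi_def lattice_points_iff)
        qed (use box that in auto)
        then show "p' \<in> X" "q' \<in> X" by auto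
      qed
      have sums: "p' $ b + q' $ b = p $ b + q $ b" for b
        using sum by (metis vector_add_component)
      have close: "\<bar>p' $ b - q' $ b\<bar> \<le> 1" for b
        using box(2,3)[of p' b] box(2,3)[of q' b] by (simp add: lo_def hi_def)
      have "energy ({#p', q'#} + K) < energy M"
      proof -
        have "(\<Sum>b\<in>UNIV. (p' $ b)\<^sup>2 + (q' $ b)\<^sup>2) < (\<Sum>b\<in>UNIV. (p $ b)\<^sup>2 + (q $ b)\<^sup>2)"
          by (rule sum_strict_mono_ex1)
            (use sum_squares_le[OF sums close] pq(2) in auto)
        then show ?thesis
          by (simp add: M energy_def sum.distrib)
      qed
      then have "nat (energy ({#p', q'#} + K)) < nat (energy M)"
        using energy_nonneg[of "{#p', q'#} + K"] by linarith
      from less.hyps[OF this] X' KX obtain N where N: "{#p', q'#} + K \<sim> N" "set_mset N \<subseteq> X"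
        "size N = size ({#p', q'#} + K)" "\<Sum>\<^sub># N = \<Sum>\<^sub># ({#p', q'#} + K)"
        "\<forall>p q a. {#p, q#} \<subseteq># N \<longrightarrow> \<bar>p $ a - q $ a\<bar> \<le> 1"
        by auto
      have "M \<sim> {#p', q'#} + K"
        unfolding M using quadratic[of p q p' q'] sum pqX X' KX by (intro add) auto
      then have "M \<sim> N"
        using N(1) trans by blast
      moreover have "\<Sum>\<^sub># N = \<Sum>\<^sub># M"
        using N(4) sum by (simp add: M add.assoc[symmetric])
      ultimately show ?thesis
        using N M by auto
    qed
  qed
  then show thesis
    using that by blast
qed

text \<open>
  A pair of factorizations \<open>y\<close>, \<open>z\<close> not connected by quadratic moves: the coordinate functions
  \<open>t i j\<close> single out \<open>y i\<close> among the \<open>y\<close> and \<open>z j\<close> among the \<open>z\<close>.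
\<close>

definition obstruction ::
  "nat \<Rightarrow> (nat \<Rightarrow> int ^ 'e) \<Rightarrow> (nat \<Rightarrow> int ^ 'e) \<Rightarrow> (nat \<Rightarrow> nat \<Rightarrow> int \<times> 'e \<times> int) \<Rightarrow> int ^ 'e \<Rightarrow> bool"
  where "obstruction k y z t lo \<longleftrightarrow>
    (\<forall>i<k. y i \<in> X \<and> z i \<in> X) \<and> (\<Sum>i<k. y i) = (\<Sum>i<k. z i) \<and>
    \<not> image_mset y (mset_set {..<k}) \<sim> image_mset z (mset_set {..<k}) \<and>
    (\<forall>i<k. \<forall>j<k. \<forall>l<k.
      coord_fun (t i j) (y l) = of_bool (l = i) \<and> coord_fun (t i j) (z l) = of_bool (l = j)) \<and>
    (\<forall>a\<in>arcs Q. 0 \<le> lo $ a) \<and>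
    (\<forall>i<k. \<forall>a. y i $ a \<in> {lo $ a, lo $ a + 1} \<and> z i $ a \<in> {lo $ a, lo $ a + 1})"

section \<open>From disconnected factorizations to obstructions\<close>

text \<open>If \<open>S - v - w\<close> decomposed in the box for some \<open>v\<close> in
  \<open>M\<close> and \<open>w\<close> in \<open>N\<close>, both sides would reach a common
  factorization through the case of size \<open>k - 1\<close>. So each such pair has a blocking
  coordinate, whose function is nonnegative with sum 1 on \<open>M\<close> and on
  \<open>N\<close>.\<close>

lemma obstruction_of_balanced:
  assumes M: "set_mset M \<subseteq> X" "size M = k" "\<Sum>\<^sub># M = S"
      "\<And>p q a. {#p, q#} \<subseteq># M \<Longrightarrow> \<bar>p $ a - q $ a\<bar> \<le> 1"
    and N: "set_mset N \<subseteq> X" "size N = k" "\<Sum>\<^sub># N = S"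
      "\<And>p q a. {#p, q#} \<subseteq># N \<Longrightarrow> \<bar>p $ a - q $ a\<bar> \<le> 1"
    and "3 \<le> k" and not: "\<not> M \<sim> N"
    and smaller: "\<And>M N. set_mset M \<subseteq> X \<Longrightarrow> set_mset N \<subseteq> X \<Longrightarrow> size M = k - 1 \<Longrightarrow> size N = k - 1 \<Longrightarrow>
      \<Sum>\<^sub># M = \<Sum>\<^sub># N \<Longrightarrow> M \<sim> N"
  shows "\<exists>y z t lo. obstruction k y z t lo"
proof -
  \<comment> \<open>Floor and ceiling of the average \<open>S / k\<close>.\<close>
  define lo where "lo = (\<chi> a. S $ a div int k)"
  define hi where "hi = (\<chi> a. (S $ a + int k - 1) div int k)"
  have S: "int k * lo $ a \<le> S $ a" "S $ a \<le> int k * hi $ a" for a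
  proof -
    have "int k * ((S $ a + int k - 1) div int k) = (S $ a + int k - 1) - (S $ a + int k - 1) mod int k"
      by (simp add: minus_mod_eq_mult_div)
    moreover have "(S $ a + int k - 1) mod int k < int k"
      using \<open>3 \<le> k\<close> by simp
    ultimately show "S $ a \<le> int k * hi $ a"
      by (simp add: hi_def)
    show "int k * lo $ a \<le> S $ a"
      using \<open>3 \<le> k\<close> by (simp add: lo_def minus_mod_eq_mult_div[symmetric])
  qed
  have hi: "lo $ a \<le> hi $ a" "hi $ a \<le> lo $ a + 1" "S $ a = int k * lo $ a \<Longrightarrow> hi $ a = lo $ a"
    "S $ a = int k * hi $ a \<Longrightarrow> hi $ a = lo $ a" for a
  proof -
    show "lo $ a \<le> hi $ a"
      unfolding lo_def hi_def using \<open>3 \<le> k\<close> by (simp add: zdiv_mono1)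
    have "(S $ a + int k - 1) div int k \<le> (S $ a + int k) div int k"
      using \<open>3 \<le> k\<close> by (intro zdiv_mono1) auto
    then show "hi $ a \<le> lo $ a + 1"
      using \<open>3 \<le> k\<close> by (simp add: lo_def hi_def)
    show "hi $ a = lo $ a" if "S $ a = int k * lo $ a"
    proof -
      have "S $ a + int k - 1 = (int k - 1) + int k * lo $ a"
        using that by simp
      then have "(S $ a + int k - 1) div int k = lo $ a + (int k - 1) div int k"
        using \<open>3 \<le> k\<close> by (simp only: div_mult_self2)
      then show ?thesis
        using \<open>3 \<le> k\<close> by (simp add: hi_def)
    qed
    show "hi $ a = lo $ a" if "S $ a = int k * hi $ a"
      using \<open>3 \<le> k\<close> that by (simp add: lo_def)
  qed
  have boxM: "lo $ a \<le> m $ a \<and> m $ a \<le> hi $ a" if "m \<in># M" for m a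
    using balanced_in_box[OF M(4) that] M(2,3) S by auto
  have boxN: "lo $ a \<le> m $ a \<and> m $ a \<le> hi $ a" if "m \<in># N" for m a
    using balanced_in_box[OF N(4) that] N(2,3) S by auto
  have S_nonneg: "0 \<le> S $ a" if "a \<in> arcs Q" for a
    using M(1) that unfolding M(3)[symmetric]
    by (induction M) (auto simp: lattice_points_iff intro!: add_nonneg_nonneg)
  have S_zero: "S $ a = 0" if "a \<notin> arcs Q" for a
    using M(1) that unfolding M(3)[symmetric]
    by (induction M) (auto simp: lattice_points_iff)
  have lo_nonneg: "0 \<le> lo $ a" if "a \<in> arcs Q" for a
    using S_nonneg[OF that] \<open>3 \<le> k\<close> by (simp add: lo_def pos_imp_zdiv_nonneg_iff)
  have conflict: "\<exists>a. \<not> (int (k - 2) * lo $ a \<le> (S - v - w) $ a \<and> (S - v - w) $ a \<le> int (k - 2) * hi $ a)"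
    if v: "v \<in># M" and w: "w \<in># N" for v w
  proof (rule ccontr)
    assume fits: "\<not> ?thesis"
    have vX: "v \<in> X" and wX: "w \<in> X"
      using v w M(1) N(1) by auto
    have "net_flow Q (S - v - w) u = int (k - 2) * \<theta> u" if "u \<in> verts Q" for u
      using net_flow_sum_mset[OF M(1) that] vX wX that \<open>3 \<le> k\<close> M(2,3)
      by (simp add: net_flow_diff lattice_points_iff is_flow_def left_diff_distrib of_nat_diff)
    then obtain K where K: "size K = k - 2" "\<Sum>\<^sub># K = S - v - w"
      "\<And>m. m \<in># K \<Longrightarrow> is_flow m \<and> (\<forall>a. lo $ a \<le> m $ a \<and> m $ a \<le> hi $ a)"
      using flow_decomposition[of "S - v - w" "k - 2" lo hi] fits by blast
    have KX: "set_mset K \<subseteq> X"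
    proof
      fix m assume m: "m \<in># K"
      show "m \<in> X"
        unfolding lattice_points_iff
      proof (intro conjI ballI allI impI)
        show "0 \<le> m $ a" if "a \<in> arcs Q" for a
          using K(3)[OF m] lo_nonneg[OF that] by (meson order_trans)
        show "m $ a = 0" if "a \<notin> arcs Q" for a
        proof -
          have "lo $ a = 0" using S_zero[OF that] by (simp add: lo_def)
          moreover from this have "hi $ a = 0" using hi(3)[of a] S_zero[OF that] by simp
          ultimately show ?thesis
            using K(3)[OF m] by (metis order_antisym)
        qed
      qed (use K(3)[OF m] in blast)
    qed
    obtain M' where M': "M = add_mset v M'" using v by (metis multi_member_split)
    obtain N' where N': "N = add_mset w N'" using w by (metis multi_member_split)
    \<comment> \<open>Both sides have size \<open>k - 1\<close> and sum \<open>S - v\<close>; below,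
      \<open>N'\<close> is treated with \<open>v\<close> and \<open>w\<close> exchanged.\<close>
    have "M' \<sim> add_mset w K"
      using M M' K wX KX \<open>3 \<le> k\<close> by (intro smaller) (auto simp: algebra_simps)
    then have 1: "M \<sim> {#v, w#} + K"
      using add[of M' "add_mset w K" "{#v#}"] vX by (simp add: M' add_mset_commute)
    have "N' \<sim> add_mset v K"
      using N N' K vX KX \<open>3 \<le> k\<close> by (intro smaller) (auto simp: algebra_simps)
    then have "N \<sim> {#v, w#} + K"
      using add[of N' "add_mset v K" "{#w#}"] wX by (simp add: N' add_mset_commute)
    with 1 not show False
      using sym trans by blast
  qed
  have "\<exists>t. coord_fun t v = 1 \<and> coord_fun t w = 1 \<and>
      (\<forall>m. m \<in># M + N \<longrightarrow> 0 \<le> coord_fun t m) \<and>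
      (\<Sum>m\<in>#M. coord_fun t m) = 1 \<and> (\<Sum>m\<in>#N. coord_fun t m) = 1"
    if v: "v \<in># M" and w: "w \<in># N" for v w
  proof -
    obtain a where a: "\<not> (int (k - 2) * lo $ a \<le> (S - v - w) $ a \<and> (S - v - w) $ a \<le> int (k - 2) * hi $ a)"
      using conflict[OF v w] by blast
    obtain t where t: "coord_fun t v = 1" "coord_fun t w = 1"
      "\<And>m. lo $ a \<le> m $ a \<Longrightarrow> m $ a \<le> hi $ a \<Longrightarrow> 0 \<le> coord_fun t m"
      "\<And>M. size M = k \<Longrightarrow> \<Sum>\<^sub># M = S \<Longrightarrow> (\<Sum>m\<in>#M. coord_fun t m) = 1"
      by (rule conflict_coord_fun[OF \<open>3 \<le> k\<close> S hi(2-4) _ _ _ _ a]) (use boxM[OF v] boxN[OF w] in auto)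
    show ?thesis
      using t(1,2) t(3)[OF conjunct1[OF boxM] conjunct2[OF boxM]]
        t(3)[OF conjunct1[OF boxN] conjunct2[OF boxN]] t(4) M(2,3) N(2,3)
      by (intro exI[of _ t]) auto
  qed
  then obtain t where t: "\<And>v w. v \<in># M \<Longrightarrow> w \<in># N \<Longrightarrow> coord_fun (t v w) v = 1 \<and> coord_fun (t v w) w = 1 \<and>
      (\<forall>m. m \<in># M + N \<longrightarrow> 0 \<le> coord_fun (t v w) m) \<and>
      (\<Sum>m\<in>#M. coord_fun (t v w) m) = 1 \<and> (\<Sum>m\<in>#N. coord_fun (t v w) m) = 1"
    by metis
  \<comment> \<open>Listing the members turns the multisets into the indexed families of an
    obstruction.\<close>
  obtain ys where ys: "mset ys = M" by (metis ex_mset)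
  obtain zs where zs: "mset zs = N" by (metis ex_mset)
  have len: "length ys = k" "length zs = k"
    using ys zs M(2) N(2) by auto
  have in_MN: "ys ! i \<in># M" "zs ! i \<in># N" if "i < k" for i
    unfolding ys[symmetric] zs[symmetric] using that len by simp_all
  \<comment> \<open>Nonnegative integers of total 1, one of which is 1, vanish elsewhere.\<close>
  have unique: "h (xs ! l) = of_bool (l = i)"
    if xs: "length xs = k" "\<And>x. x \<in> set xs \<Longrightarrow> 0 \<le> h x" "(\<Sum>x\<in>#mset xs. h x) = 1" "h (xs ! i) = 1" "i < k" "l < k"
    for xs :: "(int ^ 'e) list" and h :: "int ^ 'e \<Rightarrow> int" and i l
  proof -
    have nn: "0 \<le> h (xs ! n)" if "n < k" for n
      using xs(1,2) that by simp
    have "1 = (\<Sum>n<k. h (xs ! n))"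
      using xs(1,3) by (simp add: mset_conv_nth[of xs] sum_unfold_sum_mset multiset.map_comp o_def)
    also have "\<dots> = h (xs ! i) + (\<Sum>n\<in>{..<k} - {i}. h (xs ! n))"
      using \<open>i < k\<close> by (simp add: sum.remove)
    finally have "(\<Sum>n\<in>{..<k} - {i}. h (xs ! n)) = 0"
      using xs(4) by simp
    then have "\<forall>n\<in>{..<k} - {i}. h (xs ! n) = 0"
      using nn by (subst (asm) sum_nonneg_eq_0_iff) auto
    then show ?thesis
      using xs(4,6) by auto
  qed
  have "obstruction k ((!) ys) ((!) zs) (\<lambda>i j. t (ys ! i) (zs ! j)) lo"
    unfolding obstruction_def
  proof (intro conjI allI impI)
    show "(\<Sum>i<k. ys ! i) = (\<Sum>i<k. zs ! i)"
      using M(3) N(3) mset_conv_nth[of ys] mset_conv_nth[of zs] len ys zs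
      by (simp add: sum_unfold_sum_mset)
    show "\<not> image_mset ((!) ys) (mset_set {..<k}) \<sim> image_mset ((!) zs) (mset_set {..<k})"
      using not mset_conv_nth[of ys] mset_conv_nth[of zs] len ys zs by simp
    fix i assume i: "i < k"
    show "ys ! i \<in> X" "zs ! i \<in> X"
      using in_MN[OF i] M(1) N(1) by auto
    show "ys ! i $ a \<in> {lo $ a, lo $ a + 1}" "zs ! i $ a \<in> {lo $ a, lo $ a + 1}" for a
      using boxM[OF in_MN(1)[OF i], of a] boxN[OF in_MN(2)[OF i], of a] hi(2)[of a] by auto
    fix j l assume jl: "j < k" "l < k"
    note T = t[OF in_MN(1)[OF i] in_MN(2)[OF jl(1)]]
    show "coord_fun (t (ys ! i) (zs ! j)) (ys ! l) = of_bool (l = i)"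
      using T ys by (intro unique len i jl) auto
    show "coord_fun (t (ys ! i) (zs ! j)) (zs ! l) = of_bool (l = j)"
      using T zs by (intro unique len i jl) auto
  qed (use lo_nonneg in auto)
  then show ?thesis by blast
qed

text \<open>In a counterexample of minimal size all smaller factorizations are connected, sizes up
  to two are settled by reflexivity or a single quadratic move, and both sides may be balanced
  first.\<close>

lemma exists_obstruction:
  assumes "set_mset M \<subseteq> X" "set_mset N \<subseteq> X" "size M = size N" "\<Sum>\<^sub># M = \<Sum>\<^sub># N" "\<not> M \<sim> N"
  shows "\<exists>k y z t lo. 3 \<le> k \<and> obstruction k y z t lo"
  using assms
proof (induction "size M" arbitrary: M N rule: less_induct)
  case less
  show ?case
  proof (cases "\<exists>M' N'. size M' < size M \<and> set_mset M' \<subseteq> X \<and> set_mset N' \<subseteq> X \<and> size M' = size N' \<and>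
      \<Sum>\<^sub># M' = \<Sum>\<^sub># N' \<and> \<not> M' \<sim> N'")
    case True
    then show ?thesis using less.hyps by blast
  next
    case False
    have "3 \<le> size M"
    proof (rule ccontr)
      assume "\<not> 3 \<le> size M"
      then consider "size M = 0" | "size M = 1" | "size M = 2" by linarith
      then show False
      proof cases
        case 1
        then show False using less.prems refl by simp
      next
        case 2
        then obtain p q where "M = {#p#}" "N = {#q#}"
          using less.prems(3) by (metis size_1_singleton_mset)
        then show False using less.prems refl by simp
      next
        case 3
        then obtain p q p' q' where "M = {#p, q#}" "N = {#p', q'#}"
          using less.prems(3) by (metis size_2_mset)
        then show False using less.prems quadratic by simp
      qed
    qed
    obtain M' where M': "M \<sim> M'" "set_mset M' \<subseteq> X" "size M' = size M" "\<Sum>\<^sub># M' = \<Sum>\<^sub># M"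
      "\<And>p q a. {#p, q#} \<subseteq># M' \<Longrightarrow> \<bar>p $ a - q $ a\<bar> \<le> 1"
      by (rule exists_balanced[OF less.prems(1)]) blast
    obtain N' where N': "N \<sim> N'" "set_mset N' \<subseteq> X" "size N' = size N" "\<Sum>\<^sub># N' = \<Sum>\<^sub># N"
      "\<And>p q a. {#p, q#} \<subseteq># N' \<Longrightarrow> \<bar>p $ a - q $ a\<bar> \<le> 1"
      by (rule exists_balanced[OF less.prems(2)]) blast
    have "\<not> M' \<sim> N'"
      using less.prems(5) M'(1) N'(1) sym trans by blast
    moreover have "K \<sim> L" if "set_mset K \<subseteq> X" "set_mset L \<subseteq> X" "size K = size M - 1" "size L = size M - 1"
      "\<Sum>\<^sub># K = \<Sum>\<^sub># L" for K L
    proof -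
      have "size K < size M" "size K = size L"
        using that \<open>3 \<le> size M\<close> by auto
      with False that show ?thesis by blast
    qed
    ultimately have "\<exists>y z t lo. obstruction (size M) y z t lo"
      using M' N' less.prems(3,4) \<open>3 \<le> size M\<close>
      by (intro obstruction_of_balanced[of M' "size M" "\<Sum>\<^sub># M" N']) auto
    with \<open>3 \<le> size M\<close> show ?thesis by blast
  qed
qed

lemma obstruction_aff_dim:
  assumes "obstruction k y z t lo" and "3 \<le> k"
  shows "2 * int k - 2 \<le> aff_dim P"
  by (rule aff_dim_ge_crossing[of k y _ z t])
    (use assms in \<open>auto simp: obstruction_def lattice_points_def\<close>)

end

section \<open>The Birkhoff polytope\<close>

text \<open>The pattern of an obstruction with \<open>k = 3\<close> whose points span
  \<open>P\<close>, indexed by the type \<open>3\<close> so that indices can be computed modulo 3.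
  \<open>Birkhoff3\<close> itself is an instance.\<close>

locale crossing_points =
  fixes P :: "(real ^ 'e::finite) set" and y z :: "3 \<Rightarrow> int ^ 'e" and t :: "3 \<Rightarrow> 3 \<Rightarrow> int \<times> 'e \<times> int"
  assumes mem: "real_vec (y i) \<in> P" "real_vec (z i) \<in> P"
    and cross: "coord_fun (t i j) (y l) = of_bool (l = i)" "coord_fun (t i j) (z l) = of_bool (l = j)"
    and sum_eq: "(\<Sum>i\<in>UNIV. y i) = (\<Sum>i\<in>UNIV. z i)"
    and hull: "P \<subseteq> affine hull (range (\<lambda>i. real_vec (y i)) \<union> range (\<lambda>i. real_vec (z i)))"
begin

definition vertices :: "(real ^ 'e) set" where
  "vertices = range (\<lambda>i. real_vec (y i)) \<union> range (\<lambda>i. real_vec (z i))"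

definition comb :: "(3 \<Rightarrow> real) \<Rightarrow> (3 \<Rightarrow> real) \<Rightarrow> real ^ 'e" where
  "comb a b = (\<Sum>i\<in>UNIV. a i *\<^sub>R real_vec (y i)) + (\<Sum>i\<in>UNIV. b i *\<^sub>R real_vec (z i))"

lemma vertices_subset: "vertices \<subseteq> P"
  using mem by (auto simp: vertices_def)

lemma affine_hull_eq: "affine hull P = affine hull vertices"
  using hull vertices_subset unfolding vertices_def[symmetric]
  by (meson antisym hull_minimal affine_affine_hull hull_mono)

lemma affine_hull_comb:
  assumes "x \<in> affine hull P"
  obtains a b where "(\<Sum>i\<in>UNIV. a i) + (\<Sum>i\<in>UNIV. b i) = 1" "x = comb a b"
proof -
  let ?C = "{x. \<exists>a b. (\<Sum>i\<in>UNIV. a i) + (\<Sum>i\<in>UNIV. b i) = 1 \<and> x = comb a b}"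
  have "affine ?C"
    unfolding affine_def
  proof (intro ballI allI impI)
    fix p q and u v :: real
    assume "p \<in> ?C" "q \<in> ?C" and uv: "u + v = 1"
    then obtain a b a' b' where ab: "(\<Sum>i\<in>UNIV. a i) + (\<Sum>i\<in>UNIV. b i) = 1" "p = comb a b"
      "(\<Sum>i\<in>UNIV. a' i) + (\<Sum>i\<in>UNIV. b' i) = 1" "q = comb a' b'"
      by blast
    have "(\<Sum>i\<in>UNIV. u * a i + v * a' i) + (\<Sum>i\<in>UNIV. u * b i + v * b' i) =
      u * ((\<Sum>i\<in>UNIV. a i) + (\<Sum>i\<in>UNIV. b i)) + v * ((\<Sum>i\<in>UNIV. a' i) + (\<Sum>i\<in>UNIV. b' i))"
      by (simp add: sum.distrib sum_distrib_left distrib_left)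
    then have "(\<Sum>i\<in>UNIV. u * a i + v * a' i) + (\<Sum>i\<in>UNIV. u * b i + v * b' i) = 1"
      using ab uv by simp
    moreover have "u *\<^sub>R p + v *\<^sub>R q = comb (\<lambda>i. u * a i + v * a' i) (\<lambda>i. u * b i + v * b' i)"
      by (simp add: ab comb_def sum.distrib scaleR_sum_right scaleR_add_left scaleR_add_right)
    ultimately show "u *\<^sub>R p + v *\<^sub>R q \<in> ?C"
      by blast
  qed
  moreover have "vertices \<subseteq> ?C"
  proof -
    have "real_vec (y i) = comb (\<lambda>l. of_bool (l = i)) (\<lambda>_. 0)" for i
      by (simp add: comb_def of_bool_def if_distrib[of "\<lambda>x. x *\<^sub>R _"] cong: if_cong)
    moreover have "real_vec (z i) = comb (\<lambda>_. 0) (\<lambda>l. of_bool (l = i))" for i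
      by (simp add: comb_def of_bool_def if_distrib[of "\<lambda>x. x *\<^sub>R _"] cong: if_cong)
    moreover have "(\<Sum>l\<in>UNIV. of_bool (l = i)) = (1::real)" for i :: 3
      by (simp add: of_bool_def)
    moreover have "real_vec (y i) \<in> ?C" "real_vec (z i) \<in> ?C" for i
    proof -
      show "real_vec (y i) \<in> ?C"
        by (intro CollectI exI[of _ "\<lambda>l. of_bool (l = i)"] exI[of _ "\<lambda>_. 0"] conjI) (simp_all add: calculation)
      show "real_vec (z i) \<in> ?C"
        by (intro CollectI exI[of _ "\<lambda>_. 0"] exI[of _ "\<lambda>l. of_bool (l = i)"] conjI) (simp_all add: calculation)
    qed
    ultimately show ?thesis
      unfolding vertices_def by blast
  qed
  ultimately have "affine hull vertices \<subseteq> ?C"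
    by (rule hull_minimal[rotated])
  then show thesis
    using assms that unfolding affine_hull_eq by blast
qed

text \<open>Since both families have the same sum, a constant can be moved from the coefficients of
  one to those of the other; this freedom is used to normalize coefficients.\<close>

lemma comb_shift: "comb (\<lambda>i. a i - c) (\<lambda>i. b i + c) = comb a b"
proof -
  have "(\<Sum>i\<in>UNIV. real_vec (y i)) = (\<Sum>i\<in>UNIV. real_vec (z i))"
    using sum_eq by (auto simp: vec_eq_iff real_vec_def simp flip: of_int_sum)
  then show ?thesis
    by (simp add: comb_def scaleR_add_left scaleR_diff_left sum.distrib sum_subtractf flip: scaleR_sum_right)
qed

lemma coord_fun_comb:
  assumes "(\<Sum>i\<in>UNIV. a i) + (\<Sum>i\<in>UNIV. b i) = 1"
  shows "coord_fun (s, e, c) (comb a b) =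
    (\<Sum>i\<in>UNIV. a i * coord_fun (s, e, c) (y i)) + (\<Sum>i\<in>UNIV. b i * coord_fun (s, e, c) (z i))"
proof -
  have c: "real_of_int c = c * ((\<Sum>i\<in>UNIV. a i) + (\<Sum>i\<in>UNIV. b i))"
    using assms by simp
  show ?thesis
    by (simp add: comb_def real_vec_def, subst c)
      (simp add: sum_distrib_left distrib_left sum.distrib mult_ac)
qed

lemma cross_comb:
  assumes "(\<Sum>i\<in>UNIV. a i) + (\<Sum>i\<in>UNIV. b i) = 1"
  shows "coord_fun (t i j) (comb a b) = a i + b j"
proof -
  obtain s e c where t: "t i j = (s, e, c)" by (cases "t i j")
  have "coord_fun (t i j) (comb a b) =
    (\<Sum>l\<in>UNIV. a l * coord_fun (t i j) (y l)) + (\<Sum>l\<in>UNIV. b l * coord_fun (t i j) (z l))"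
    unfolding t by (rule coord_fun_comb[OF assms])
  then show ?thesis
    by (simp add: cross of_bool_def if_distrib[of "\<lambda>x. _ * x"] if_distrib[of real_of_int] cong: if_cong)
qed

text \<open>Shift so that the smallest \<open>a i\<close> becomes zero; each new \<open>b j\<close>
  is then the value of \<open>t i j\<close> at \<open>x\<close> for the minimizing
  \<open>i\<close>.\<close>

lemma nonneg_in_convex_hull:
  assumes "x \<in> affine hull P" and nonneg: "\<And>i j. 0 \<le> coord_fun (t i j) x"
  obtains a b where "(\<Sum>i\<in>UNIV. a i) + (\<Sum>i\<in>UNIV. b i) = 1" "x = comb a b"
    "\<And>i. 0 \<le> a i" "\<And>i. 0 \<le> b i"
proof -
  obtain a b where ab: "(\<Sum>i\<in>UNIV. a i) + (\<Sum>i\<in>UNIV. b i) = 1" "x = comb a b"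
    using affine_hull_comb[OF assms(1)] .
  define c where "c = Min (range a)"
  have c: "c \<le> a i" for i
    by (simp add: c_def)
  have "c \<in> range a"
    unfolding c_def by (rule Min_in) auto
  then obtain i where i: "c = a i" by blast
  have "0 \<le> b j + c" for j
    using nonneg[of i j] ab by (simp add: cross_comb i)
  moreover have "(\<Sum>i\<in>UNIV. a i - c) + (\<Sum>i\<in>UNIV. b i + c) = 1"
    using ab(1) by (simp add: sum.distrib sum_subtractf)
  ultimately show thesis
    using that[of "\<lambda>i. a i - c" "\<lambda>i. b i + c"] ab(2) c by (simp add: comb_shift)
qed

lemma comb_in_convex_hull:
  assumes "(\<Sum>i\<in>UNIV. a i) + (\<Sum>i\<in>UNIV. b i) = 1" "\<And>i. 0 \<le> a i" "\<And>i. 0 \<le> b i"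
  shows "comb a b \<in> convex hull vertices"
proof -
  let ?I = "(UNIV :: 3 set) <+> (UNIV :: 3 set)"
  let ?u = "case_sum a b" and ?g = "case_sum (\<lambda>i. real_vec (y i)) (\<lambda>i. real_vec (z i))"
  have "(\<Sum>i\<in>?I. ?u i *\<^sub>R ?g i) \<in> convex hull vertices"
    by (rule convex_sum)
      (use assms in \<open>auto simp: sum.Plus vertices_def simp del: UNIV_Plus_UNIV intro!: hull_inc split: sum.splits\<close>)
  then show ?thesis
    by (simp add: sum.Plus comb_def del: UNIV_Plus_UNIV)
qed

end

section \<open>Permutation matrices of size three as rotations and reflections\<close>

text \<open>Modulo 3 the number 2 is invertible, so the linear system has one solution: a rotation
  and a reflection agree in exactly one row.\<close>

lemma mod_3_solve: "c - r = i \<and> c + r = j \<longleftrightarrow> r = i - j \<and> c = - i - j" for i j r c :: 3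
proof -
  have "\<forall>r c :: 3. r = (c - r) - (c + r) \<and> c = - (c - r) - (c + r)"
    unfolding forall_3 by simp
  moreover have "\<forall>i j :: 3. (- i - j) - (i - j) = i \<and> (- i - j) + (i - j) = j"
    unfolding forall_3 by simp
  ultimately show ?thesis by metis
qed

text \<open>The matrix of the rotation \<open>r + i\<close> of the residues \<open>r\<close> modulo
  3; \<open>odd_perm j\<close> belongs to the reflection \<open>j - r\<close>.\<close>

definition even_perm :: "3 \<Rightarrow> int ^ (3 \<times> 3)" where
  "even_perm i = (\<chi> rc. of_bool (snd rc - fst rc = i))"

definition odd_perm :: "3 \<Rightarrow> int ^ (3 \<times> 3)" where
  "odd_perm j = (\<chi> rc. of_bool (snd rc + fst rc = j))"

lemma Birkhoff3_eq:
  "Birkhoff3 = convex hull (range (\<lambda>i. real_vec (even_perm i)) \<union> range (\<lambda>i. real_vec (odd_perm i)))"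
proof -
  let ?M = "\<lambda>\<pi> :: 3 \<Rightarrow> 3. (\<chi> ij. if \<pi> (fst ij) = snd ij then 1 else 0) :: real ^ (3 \<times> 3)"
  have even: "real_vec (even_perm i) = ?M (\<lambda>r. r + i)" for i
    by (auto simp: vec_eq_iff real_vec_def even_perm_def algebra_simps)
  have odd: "real_vec (odd_perm j) = ?M (\<lambda>r. j - r)" for j
    by (auto simp: vec_eq_iff real_vec_def odd_perm_def algebra_simps)
  have bij: "bij (\<lambda>r. r + i)" "bij (\<lambda>r. j - r)" for i j :: 3
    by (rule o_bij[of "\<lambda>r. r - i"]; simp add: fun_eq_iff)
      (rule o_bij[of "\<lambda>r. j - r"]; simp add: fun_eq_iff)
  have perm: "\<pi> \<in> range (\<lambda>i r. r + i) \<union> range (\<lambda>j r. j - r)" if "bij \<pi>" for \<pi> :: "3 \<Rightarrow> 3"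
  proof -
    have inj: "\<pi> 1 \<noteq> \<pi> 2" "\<pi> 2 \<noteq> \<pi> 3" "\<pi> 1 \<noteq> \<pi> 3"
      using that by (auto simp: bij_def inj_eq)
    \<comment> \<open>The value at 1 determines a permutation up to a swap of the two others; the
      two options are the rotation and the reflection with that value.\<close>
    have "\<forall>a b c :: 3. a \<noteq> b \<longrightarrow> b \<noteq> c \<longrightarrow> a \<noteq> c \<longrightarrow>
      (b = 2 + (a - 1) \<and> c = 3 + (a - 1)) \<or> (b = (a + 1) - 2 \<and> c = (a + 1) - 3)"
      unfolding forall_3 by simp
    with inj have "(\<pi> 2 = 2 + (\<pi> 1 - 1) \<and> \<pi> 3 = 3 + (\<pi> 1 - 1)) \<or>
      (\<pi> 2 = (\<pi> 1 + 1) - 2 \<and> \<pi> 3 = (\<pi> 1 + 1) - 3)"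
      by blast
    then have "(\<forall>r. \<pi> r = r + (\<pi> 1 - 1)) \<or> (\<forall>r. \<pi> r = (\<pi> 1 + 1) - r)"
      unfolding forall_3 by auto
    then obtain i j where "(\<forall>r. \<pi> r = r + i) \<or> (\<forall>r. \<pi> r = j - r)"
      by blast
    then have "\<pi> = (\<lambda>r. r + i) \<or> \<pi> = (\<lambda>r. j - r)"
      by (simp only: fun_eq_iff)
    then show ?thesis by blast
  qed
  have "{\<pi>. bij \<pi>} = range (\<lambda>i r. r + i) \<union> range (\<lambda>j r. j - r :: 3)"
    using perm bij by auto
  then have "?M ` {\<pi>. bij \<pi>} = range (\<lambda>i. real_vec (even_perm i)) \<union> range (\<lambda>i. real_vec (odd_perm i))"
    unfolding even odd by (simp only: image_Un image_image)
  moreover have "?M ` {\<pi>. bij \<pi>} = {?M \<pi> | \<pi>. bij \<pi>}"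
    by blast
  ultimately show ?thesis
    by (simp add: Birkhoff3_def)
qed

text \<open>The position \<open>(i - j, - i - j)\<close> is the common one of the \<open>i\<close>-th even and the \<open>j\<close>-th odd permutation.\<close>

interpretation Birkhoff3: crossing_points Birkhoff3 even_perm odd_perm "\<lambda>i j. (1, (i - j, - i - j), 0)"
proof
  fix i j l
  show "real_vec (even_perm i) \<in> Birkhoff3" "real_vec (odd_perm i) \<in> Birkhoff3"
    unfolding Birkhoff3_eq by (auto intro!: hull_inc)
  have 1: "(- i - j) - (i - j) = i" "(- i - j) + (i - j) = j"
    using mod_3_solve[of "- i - j" "i - j" i j] by auto
  show "coord_fun (1, (i - j, - i - j), 0) (even_perm l) = of_bool (l = i)"
    using 1(1) by (auto simp: even_perm_def)
  show "coord_fun (1, (i - j, - i - j), 0) (odd_perm l) = of_bool (l = j)"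
    using 1(2) by (auto simp: odd_perm_def)
next
  have "(\<Sum>i\<in>UNIV. of_bool (a = i)) = (1 :: int)" for a :: 3
    by (simp add: of_bool_def)
  then show "(\<Sum>i\<in>UNIV. even_perm i) = (\<Sum>i\<in>UNIV. odd_perm i)"
    by (simp add: vec_eq_iff even_perm_def odd_perm_def)
  show "Birkhoff3 \<subseteq> affine hull (range (\<lambda>i. real_vec (even_perm i)) \<union> range (\<lambda>i. real_vec (odd_perm i)))"
    unfolding Birkhoff3_eq by (rule convex_hull_subset_affine_hull)
qed

lemma Birkhoff3_nonneg:
  assumes "x \<in> Birkhoff3"
  shows "0 \<le> x $ rc"
proof -
  have "convex {x :: real ^ (3 \<times> 3). 0 \<le> x $ rc}"
    by (auto simp: convex_def)
  then have "Birkhoff3 \<subseteq> {x. 0 \<le> x $ rc}"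
    unfolding Birkhoff3_eq
    by (intro hull_minimal) (auto simp: real_vec_def even_perm_def odd_perm_def)
  with assms show ?thesis by blast
qed

section \<open>Comparison with the Birkhoff polytope\<close>

context crossing_points
begin

text \<open>All \<open>a i + b j\<close> are integers and some one is at least 1, so this
  \<open>a i\<close> and \<open>b j\<close> use up the total weight 1. As \<open>b (j + 1)\<close>
  is then zero, \<open>a i\<close> is itself the integer value of \<open>t i (j + 1)\<close>, hence
  0 or 1.\<close>

lemma lattice_point_cases:
  assumes "m \<in> lattice_points P" and nonneg: "\<And>i j. 0 \<le> coord_fun (t i j) m"
  shows "m \<in> range y \<union> range z"
proof -
  have inP: "real_vec m \<in> affine hull P"
    using assms(1) by (auto simp: lattice_points_def intro: hull_inc)
  have nn: "0 \<le> coord_fun (t i j) (real_vec m)" for i j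
    using nonneg[of i j] by (simp add: coord_fun_real_vec)
  obtain a b where ab: "(\<Sum>i\<in>UNIV. a i) + (\<Sum>i\<in>UNIV. b i) = 1" "real_vec m = comb a b"
    "\<And>i. 0 \<le> a i" "\<And>i. 0 \<le> b i"
    by (rule nonneg_in_convex_hull[OF inP nn]) blast
  have int: "of_int (coord_fun (t i j) m) = a i + b j" for i j
    using cross_comb[OF ab(1), of i j] by (simp add: coord_fun_real_vec flip: ab(2))
  have "\<exists>i j. coord_fun (t i j) m \<noteq> 0"
  proof (rule ccontr)
    assume "\<not> ?thesis"
    then have zero: "a i + b j = 0" for i j
      using int[of i j] by simp
    have "a i = 0 \<and> b i = 0" for i
      using zero[of i i] ab(3)[of i] ab(4)[of i] by linarith
    with ab(1) show False by simp
  qed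
  then obtain i j where "coord_fun (t i j) m \<noteq> 0" by blast
  with nonneg[of i j] have "1 \<le> coord_fun (t i j) m" by linarith
  then have ge1: "1 \<le> a i + b j"
    using int[of i j] by (metis of_int_1 of_int_le_iff)
  have split: "sum u UNIV = u l + sum u (- {l})" for u :: "3 \<Rightarrow> real" and l
    by (simp add: sum.remove[of UNIV l] Compl_eq_Diff_UNIV)
  have rest: "sum a (- {i}) = 0" "sum b (- {j}) = 0" and eq1: "a i + b j = 1"
    using ab(1) ge1 split[of a i] split[of b j] sum_nonneg[of "- {i}" a] sum_nonneg[of "- {j}" b] ab(3,4)
    by force+
  have a0: "a l = 0" if "l \<noteq> i" for l
    using rest(1) ab(3) that by (subst (asm) sum_nonneg_eq_0_iff) auto
  have b0: "b l = 0" if "l \<noteq> j" for l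
    using rest(2) ab(4) that by (subst (asm) sum_nonneg_eq_0_iff) auto
  have "j + 1 \<noteq> j" by simp
  then have ai: "of_int (coord_fun (t i (j + 1)) m) = a i"
    using int[of i "j + 1"] b0 by simp
  have "a i \<le> 1" using eq1 ab(4)[of j] by linarith
  then have "coord_fun (t i (j + 1)) m \<le> 1"
    using ai by linarith
  with nonneg[of i "j + 1"] consider "coord_fun (t i (j + 1)) m = 0" | "coord_fun (t i (j + 1)) m = 1"
    by linarith
  then consider "a i = 0" | "a i = 1"
    using ai by (metis of_int_0 of_int_1)
  then show ?thesis
  proof cases
    case 1
    then have "a l = 0" "b l = of_bool (l = j)" for l
      using a0[of l] b0[of l] eq1 by (cases "l = i"; cases "l = j"; simp)+
    then have "real_vec m = real_vec (z j)"
      unfolding ab(2) by (simp add: comb_def of_bool_def if_distrib[of "\<lambda>x. x *\<^sub>R _"] cong: if_cong)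
    then show ?thesis by (auto simp: real_vec_def vec_eq_iff)
  next
    case 2
    then have "b l = 0" "a l = of_bool (l = i)" for l
      using a0[of l] b0[of l] eq1 by (cases "l = i"; cases "l = j"; simp)+
    then have "real_vec m = real_vec (y i)"
      unfolding ab(2) by (simp add: comb_def of_bool_def if_distrib[of "\<lambda>x. x *\<^sub>R _"] cong: if_cong)
    then show ?thesis by (auto simp: real_vec_def vec_eq_iff)
  qed
qed

text \<open>The values \<open>a i + b j\<close> of the functions \<open>t i j\<close>, arranged as a
  matrix, give the equivalence. They determine the coefficients up to a shift, which yields
  injectivity and, after normalizing, integral preimages of integral points.\<close>

lemma equivalent_Birkhoff3:
  assumes "convex P" and nonneg: "\<And>x i j. x \<in> P \<Longrightarrow> 0 \<le> coord_fun (t i j) x"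
  shows "integral_affinely_equivalent P Birkhoff3"
proof -
  \<comment> \<open>Entry \<open>(r, c)\<close> carries \<open>t i j\<close> for
    \<open>i = c - r\<close> and \<open>j = c + r\<close>, so \<open>t i j\<close> sits where
    rotation \<open>i\<close> and reflection \<open>j\<close> agree.\<close>
  define T where "T rc = t (snd rc - fst rc) (snd rc + fst rc)" for rc :: "3 \<times> 3"
  define f where "f x = (\<chi> rc. coord_fun (T rc) x)" for x :: "real ^ 'e"
  define g where "g x = (\<chi> rc. of_int (fst (T rc)) * x $ fst (snd (T rc)))" for x :: "real ^ 'e"
  define w :: "real ^ (3 \<times> 3)" where "w = (\<chi> rc. of_int (snd (snd (T rc))))"
  \<comment> \<open>As a linear map followed by a translation, \<open>f\<close> commutes with affine
    and convex hulls.\<close>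
  have fg: "f = (\<lambda>x. w + x) \<circ> g"
    by (auto simp: fun_eq_iff vec_eq_iff f_def g_def w_def coord_fun_eq)
  have lin: "linear g"
    by (rule linearI) (auto simp: g_def vec_eq_iff algebra_simps)
  have f_y: "f (real_vec (y l)) = real_vec (even_perm l)" for l
    by (auto simp: f_def T_def vec_eq_iff coord_fun_real_vec cross real_vec_nth even_perm_def)
  have f_z: "f (real_vec (z l)) = real_vec (odd_perm l)" for l
    by (auto simp: f_def T_def vec_eq_iff coord_fun_real_vec cross real_vec_nth odd_perm_def)
  have f_vertices: "f ` vertices = Birkhoff3.vertices"
    by (simp add: vertices_def Birkhoff3.vertices_def image_Un image_image f_y f_z)
  have f_aff: "f ` (affine hull S) = affine hull (f ` S)" for S
    unfolding fg image_comp[symmetric]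
    using affine_hull_linear_image[of g S] lin
    by (simp add: affine_hull_translation linear_conv_bounded_linear)
  have f_conv: "f ` (convex hull S) = convex hull (f ` S)" for S
    unfolding fg image_comp[symmetric]
    by (simp add: convex_hull_translation convex_hull_linear_image[OF lin])
  have f_comb: "f (comb a b) $ (i - j, - i - j) = a i + b j"
    if "(\<Sum>i\<in>UNIV. a i) + (\<Sum>i\<in>UNIV. b i) = 1" for a b i j
  proof -
    have "(- i - j) - (i - j) = i" "(- i - j) + (i - j) = j"
      using mod_3_solve[of "- i - j" "i - j" i j] by blast+
    then have "T (i - j, - i - j) = t i j"
      by (simp only: T_def fst_conv snd_conv)
    then show ?thesis
      by (simp add: f_def cross_comb[OF that])
  qed
  have P_eq: "P = convex hull vertices"
  proof
    show "convex hull vertices \<subseteq> P"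
      using \<open>convex P\<close> vertices_subset by (simp add: hull_minimal)
    show "P \<subseteq> convex hull vertices"
    proof
      fix x assume x: "x \<in> P"
      then show "x \<in> convex hull vertices"
        using nonneg_in_convex_hull[OF hull_inc[OF x] nonneg[OF x]] comb_in_convex_hull by metis
    qed
  qed
  have inj: "inj_on f (affine hull P)"
  proof (rule inj_onI)
    fix x x' assume x: "x \<in> affine hull P" "x' \<in> affine hull P" "f x = f x'"
    obtain a b where ab: "(\<Sum>i\<in>UNIV. a i) + (\<Sum>i\<in>UNIV. b i) = 1" "x = comb a b"
      using affine_hull_comb[OF x(1)] .
    obtain a' b' where ab': "(\<Sum>i\<in>UNIV. a' i) + (\<Sum>i\<in>UNIV. b' i) = 1" "x' = comb a' b'"
      using affine_hull_comb[OF x(2)] .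
    have eq: "a i + b j = a' i + b' j" for i j
      using f_comb[OF ab(1), of i j] f_comb[OF ab'(1), of i j] x(3) ab(2) ab'(2) by simp
    define c where "c = a 1 - a' 1"
    have "a' i = a i - c" for i
      using eq[of i 1] eq[of 1 1] unfolding c_def by linarith
    moreover have "b' i = b i + c" for i
      using eq[of 1 i] unfolding c_def by linarith
    ultimately have "a' = (\<lambda>i. a i - c)" "b' = (\<lambda>i. b i + c)"
      by blast+
    then show "x = x'"
      by (simp add: ab ab' comb_shift)
  qed
  have aff_image: "f ` (affine hull P) = affine hull Birkhoff3"
    using f_aff[of vertices] f_vertices by (simp add: affine_hull_eq Birkhoff3.affine_hull_eq)
  have lattice: "f ` (affine hull P \<inter> range real_vec) = affine hull Birkhoff3 \<inter> range real_vec"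
  proof (intro equalityI subsetI)
    fix u assume "u \<in> f ` (affine hull P \<inter> range real_vec)"
    then obtain m where m: "u = f (real_vec m)" "real_vec m \<in> affine hull P" by blast
    have "f (real_vec m) = real_vec (\<chi> rc. coord_fun (T rc) m)"
      by (simp add: f_def vec_eq_iff coord_fun_real_vec real_vec_def[of "vec_lambda _"])
    then show "u \<in> affine hull Birkhoff3 \<inter> range real_vec"
      using m aff_image by blast
  next
    fix u assume u: "u \<in> affine hull Birkhoff3 \<inter> range real_vec"
    then obtain x where x: "x \<in> affine hull P" "u = f x"
      using aff_image by blast
    obtain a b where ab: "(\<Sum>i\<in>UNIV. a i) + (\<Sum>i\<in>UNIV. b i) = 1" "x = comb a b"
      using affine_hull_comb[OF x(1)] .
    obtain m where m: "u = real_vec m"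
      using u by blast
    have int: "a i + b j \<in> \<int>" for i j
    proof -
      have "a i + b j = of_int (m $ (i - j, - i - j))"
        using f_comb[OF ab(1), of i j] m x(2) ab(2) by (simp add: real_vec_nth)
      then show ?thesis by simp
    qed
    \<comment> \<open>The shift by \<open>a 1\<close> makes all coefficients integral:
      \<open>b' i\<close> is the value for \<open>(1, i)\<close>, and \<open>a' i\<close> is the
      difference of the values for \<open>(i, 1)\<close> and \<open>(1, 1)\<close>.\<close>
    define a' b' where "a' i = a i - a 1" and "b' i = b i + a 1" for i
    have b': "b' i \<in> \<int>" for i
      using int[of 1 i] by (simp add: b'_def add.commute)
    have a': "a' i \<in> \<int>" for i
      using Ints_diff[OF int[of i 1] int[of 1 1]] by (simp add: a'_def)
    have "x = comb a' b'"
      unfolding ab(2) a'_def b'_def by (simp add: comb_shift)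
    then have "x = real_vec ((\<Sum>i\<in>UNIV. \<lfloor>a' i\<rfloor> *s y i) + (\<Sum>i\<in>UNIV. \<lfloor>b' i\<rfloor> *s z i))"
      using a' b' by (simp add: vec_eq_iff comb_def real_vec_def)
    then show "u \<in> f ` (affine hull P \<inter> range real_vec)"
      using x by blast
  qed
  have "affine_map_on (affine hull P) f"
    unfolding affine_map_on_def
  proof (intro ballI allI impI)
    fix x x' :: "real ^ 'e" and u v :: real
    assume "u + v = 1"
    then have v: "v = 1 - u" by simp
    show "f (u *\<^sub>R x + v *\<^sub>R x') = u *\<^sub>R f x + v *\<^sub>R f x'"
      unfolding v by (simp add: vec_eq_iff f_def coord_fun_eq algebra_simps)
  qed
  moreover have "f ` P = Birkhoff3"
    using f_conv[of vertices] f_vertices P_eq by (simp add: Birkhoff3_eq Birkhoff3.vertices_def)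
  ultimately show ?thesis
    unfolding integral_affinely_equivalent_def using inj lattice aff_image by (auto simp: bij_betw_def)
qed

section \<open>Factorizations connected by the cubic move\<close>

lemma y_eq_iff: "y i = y l \<longleftrightarrow> i = l"
  by (metis cross(1) of_bool_eq_iff)

lemma z_eq_iff: "z i = z l \<longleftrightarrow> i = l"
  by (metis cross(2) of_bool_eq_iff)

text \<open>The function \<open>t i (j + 1)\<close> is 1 at \<open>y i\<close> and 0 at
  \<open>z j\<close>.\<close>

lemma y_neq_z: "y i \<noteq> z j"
proof
  assume "y i = z j"
  then have "of_bool True = (of_bool (j = j + 1) :: int)"
    using cross(1)[of i "j + 1" i] cross(2)[of i "j + 1" j] by simp
  then show False by simp
qed

text \<open>Supplies invariants: by \<open>sum_coord_fun_cong\<close> the left side depends only on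
  the size and the sum of \<open>M\<close>.\<close>

lemma sum_coord_fun:
  assumes "set_mset M \<subseteq> range y \<union> range z"
  shows "(\<Sum>m\<in>#M. coord_fun (t i j) m) = int (count M (y i) + count M (z j))"
  using assms
  by (induction M) (auto simp: cross y_eq_iff z_eq_iff y_neq_z y_neq_z[symmetric])

lemma sum_three: "\<Sum>\<^sub># {#y 1, y 2, y 3#} = \<Sum>\<^sub># {#z 1, z 2, z 3#}"
  using sum_eq by (simp add: sum_3 add.assoc)

text \<open>By the invariants, an excess of one \<open>y\<close> in \<open>M\<close> forces an
  excess of every \<open>z\<close> in \<open>N\<close>, and then of every \<open>y\<close> in
  \<open>M\<close>. So the three \<open>y\<close> can be split off from \<open>M\<close> and the
  three \<open>z\<close> from \<open>N\<close>; the cubic move matches them and the rest is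
  smaller.\<close>

lemma factorizations_connected:
  assumes nonneg: "\<And>m i j. m \<in> lattice_points P \<Longrightarrow> 0 \<le> coord_fun (t i j) m"
    and R: "multiset_congruence (lattice_points P) R"
    and cubic: "R {#y 1, y 2, y 3#} {#z 1, z 2, z 3#}"
    and "set_mset M \<subseteq> lattice_points P" "set_mset N \<subseteq> lattice_points P" "size M = size N" "\<Sum>\<^sub># M = \<Sum>\<^sub># N"
  shows "R M N"
  using assms(4-)
proof (induction "size M" arbitrary: M N rule: less_induct)
  case less
  interpret multiset_congruence "lattice_points P" R by (rule R)
  have X: "lattice_points P \<subseteq> range y \<union> range z"
    using lattice_point_cases nonneg by blast
  have zX: "z i \<in> lattice_points P" for i
    using mem by (auto simp: lattice_points_def)
  have excess: "R M' N'" if "size M' = size M" and M': "set_mset M' \<subseteq> lattice_points P" "set_mset N' \<subseteq> lattice_points P"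
    "size M' = size N'" "\<Sum>\<^sub># M' = \<Sum>\<^sub># N'" and i0: "count N' (y i0) < count M' (y i0)" for M' N' i0
  proof -
    have eq: "count M' (y i) + count M' (z j) = count N' (y i) + count N' (z j)" for i j
      using sum_coord_fun[OF subset_trans[OF M'(1) X], of i j] sum_coord_fun[OF subset_trans[OF M'(2) X], of i j]
        sum_coord_fun_cong[OF M'(3,4), of "t i j"] by simp
    have z: "count M' (z j) < count N' (z j)" for j
      using eq[of i0 j] i0 by linarith
    have y: "count N' (y i) < count M' (y i)" for i
      using eq[of i 1] z[of 1] by linarith
    have "0 < count M' (y i)" "0 < count N' (z i)" for i
      using y[of i] z[of i] by linarith+
    then have in_MN: "y i \<in># M'" "z i \<in># N'" for i
      by simp_all
    have "{#y 1, y 2, y 3#} \<subseteq># M'"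
      using in_MN by (intro mset_subset_eqI) (auto simp: y_eq_iff)
    then obtain M1 where M1: "M' = {#y 1, y 2, y 3#} + M1"
      by (metis mset_subset_eq_exists_conv)
    have "{#z 1, z 2, z 3#} \<subseteq># N'"
      using in_MN by (intro mset_subset_eqI) (auto simp: z_eq_iff)
    then obtain N1 where N1: "N' = {#z 1, z 2, z 3#} + N1"
      by (metis mset_subset_eq_exists_conv)
    have "\<Sum>\<^sub># {#y 1, y 2, y 3#} + \<Sum>\<^sub># M1 = \<Sum>\<^sub># {#z 1, z 2, z 3#} + \<Sum>\<^sub># N1"
      using M'(4) unfolding M1 N1 by (simp only: sum_mset.union)
    then have "\<Sum>\<^sub># M1 = \<Sum>\<^sub># N1"
      unfolding sum_three by simp
    then have "R M1 N1"
      using less.hyps[of M1 N1] that(1) M' unfolding M1 N1 by auto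
    then have "R (M1 + {#z 1, z 2, z 3#}) (N1 + {#z 1, z 2, z 3#})"
      by (rule add) (use zX in auto)
    then have "R ({#z 1, z 2, z 3#} + M1) ({#z 1, z 2, z 3#} + N1)"
      by (simp only: union_commute)
    moreover have "R ({#y 1, y 2, y 3#} + M1) ({#z 1, z 2, z 3#} + M1)"
      by (rule add[OF cubic]) (use M' M1 in auto)
    ultimately show ?thesis
      unfolding M1 N1 by (rule trans[rotated])
  qed
  show ?case
  proof (cases "\<forall>i. count M (y i) = count N (y i)")
    case True
    \<comment> \<open>Equal counts of the \<open>y\<close> give equal counts of the \<open>z\<close>
      by the invariants, and no other lattice points occur.\<close>
    have "count M x = count N x" for x
    proof -
      consider i where "x = y i" | i where "x = z i" | "x \<notin> range y \<union> range z" by blast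
      then show ?thesis
      proof cases
        case 1
        with True show ?thesis by simp
      next
        case 2
        then show ?thesis
          using sum_coord_fun[OF subset_trans[OF less.prems(1) X], of 1 i]
            sum_coord_fun[OF subset_trans[OF less.prems(2) X], of 1 i] True[rule_format, of 1]
            sum_coord_fun_cong[OF less.prems(3,4), of "t 1 i"] by simp
      next
        case 3
        then have "x \<notin># M" "x \<notin># N" using X less.prems by auto
        then show ?thesis by (simp add: not_in_iff)
      qed
    qed
    then have "M = N" by (simp add: multiset_eq_iff)
    then show ?thesis using refl less.prems by simp
  next
    case False
    then obtain i0 where "count N (y i0) < count M (y i0) \<or> count M (y i0) < count N (y i0)"
      by (metis linorder_neqE_nat)
    then show ?thesis
    proof
      assume "count N (y i0) < count M (y i0)"
      from excess[OF HOL.refl less.prems this] show ?thesis .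
    next
      assume "count M (y i0) < count N (y i0)"
      from excess[OF less.prems(3)[symmetric] less.prems(2,1) less.prems(3,4)[symmetric] this]
      show ?thesis by (rule sym)
    qed
  qed
qed

end

section \<open>The toric ideal of polytopes equivalent to the Birkhoff polytope\<close>

text \<open>Averages replace sums because sums can leave the set on which \<open>f\<close> is
  affine. Adding \<open>x\<close> to \<open>k\<close> members mixes \<open>x\<close> and the old
  average with weights \<open>1 / (k + 1)\<close> and \<open>k / (k + 1)\<close>.\<close>

lemma affine_map_on_average:
  fixes M :: "'a::real_vector multiset"
  assumes A: "affine A" and f: "affine_map_on A f" and "set_mset M \<subseteq> A" "M \<noteq> {#}"
  shows "(1 / size M) *\<^sub>R \<Sum>\<^sub># M \<in> A \<and> f ((1 / size M) *\<^sub>R \<Sum>\<^sub># M) = (1 / size M) *\<^sub>R (\<Sum>x\<in>#M. f x)"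
  using assms(3,4)
proof (induction M)
  case (add x M)
  show ?case
  proof (cases "M = {#}")
    case False
    define k where "k = real (size M)"
    have k: "k > 0" using False by (simp add: k_def nonempty_has_size)
    define u v where "u = 1 / (k + 1)" and "v = k / (k + 1)"
    have uv: "u + v = 1" using k by (simp add: u_def v_def field_simps)
    define a where "a = (1 / k) *\<^sub>R \<Sum>\<^sub># M"
    have IH: "a \<in> A" "f a = (1 / k) *\<^sub>R (\<Sum>x\<in>#M. f x)"
      using add False by (auto simp: a_def k_def)
    have x: "x \<in> A" using add.prems by simp
    have size: "1 / real (size (add_mset x M)) = u"
      by (simp add: u_def k_def add.commute)
    have vk: "v * (1 / k) = u"
      using k by (simp add: u_def v_def)
    have "(1 / real (size (add_mset x M))) *\<^sub>R \<Sum>\<^sub># (add_mset x M) = u *\<^sub>R x + v *\<^sub>R a"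
      unfolding size a_def scaleR_scaleR vk by (simp add: scaleR_add_right)
    moreover have "u *\<^sub>R x + v *\<^sub>R a \<in> A"
      using A x IH(1) uv unfolding affine_def by blast
    moreover have "f (u *\<^sub>R x + v *\<^sub>R a) = u *\<^sub>R f x + v *\<^sub>R f a"
      using f x IH(1) uv unfolding affine_map_on_def by blast
    moreover have "\<dots> = (1 / real (size (add_mset x M))) *\<^sub>R (\<Sum>x\<in>#add_mset x M. f x)"
      unfolding size IH(2) scaleR_scaleR vk by (simp add: scaleR_add_right)
    ultimately show ?thesis by simp
  qed (use add in simp)
qed simp

text \<open>An equivalence matches the lattice points and preserves equality of sums for multisets
  of equal size. So a congruence on \<open>P\<close> pulls back to \<open>Birkhoff3\<close>, where
  the cubic move connects all factorizations.\<close>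

lemma Birkhoff3_cubic:
  fixes P :: "(real ^ 'n::finite) set"
  assumes "integral_affinely_equivalent P Birkhoff3"
  shows "generated_by_cubic_and_quadrics P"
proof -
  obtain f where f: "affine_map_on (affine hull P) f" "bij_betw f (affine hull P) (affine hull Birkhoff3)"
    "f ` (affine hull P \<inter> range real_vec) = affine hull Birkhoff3 \<inter> range real_vec" "f ` P = Birkhoff3"
    using assms unfolding integral_affinely_equivalent_def by blast
  have inj: "x = x'" if "f x = f x'" "x \<in> affine hull P" "x' \<in> affine hull P" for x x'
    using f(2) that by (auto simp: bij_betw_def inj_on_def)
  have P_hull: "x \<in> affine hull P" if "x \<in> P" for x
    using that by (rule hull_inc)
  let ?X = "lattice_points P" and ?B = "lattice_points Birkhoff3"
  have "\<exists>m\<in>?X. f (real_vec m) = real_vec u" if "u \<in> ?B" for u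
  proof -
    have u: "real_vec u \<in> Birkhoff3"
      using that by (simp add: lattice_points_def)
    then obtain x where x: "x \<in> P" "f x = real_vec u"
      using f(4) by (metis imageE)
    have "real_vec u \<in> f ` (affine hull P \<inter> range real_vec)"
      unfolding f(3) using u by (simp add: hull_inc)
    then obtain m where m: "f (real_vec m) = real_vec u" "real_vec m \<in> affine hull P"
      by force
    then have "x = real_vec m"
      using inj x P_hull by simp
    with m x show ?thesis by (auto simp: lattice_points_def)
  qed
  then obtain g where g: "\<And>u. u \<in> ?B \<Longrightarrow> g u \<in> ?X" "\<And>u. u \<in> ?B \<Longrightarrow> f (real_vec (g u)) = real_vec u"
    by metis
  have surj: "\<exists>u\<in>?B. m = g u" if "m \<in> ?X" for m
  proof -
    have m: "real_vec m \<in> P"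
      using that by (simp add: lattice_points_def)
    then have "f (real_vec m) \<in> affine hull Birkhoff3 \<inter> range real_vec"
      unfolding f(3)[symmetric] using P_hull by blast
    then obtain u where u: "f (real_vec m) = real_vec u" by blast
    then have "u \<in> ?B"
      using m f(4) by (metis imageI lattice_points_def mem_Collect_eq)
    moreover from this have "real_vec m = real_vec (g u)"
      using g[of u] u m by (intro inj P_hull) (auto simp: lattice_points_def)
    ultimately show ?thesis by (auto simp: real_vec_inject)
  qed
  \<comment> \<open>For equal sizes, equal sums mean equal averages; \<open>f\<close> maps averages
    to averages and is injective on the affine hull.\<close>
  have sums: "(\<Sum>u\<in>#M. g u) = (\<Sum>u\<in>#N. g u) \<longleftrightarrow> \<Sum>\<^sub># M = \<Sum>\<^sub># N"
    if MN: "set_mset M \<subseteq> ?B" "set_mset N \<subseteq> ?B" "size M = size N" for M N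
  proof (cases "M = {#}")
    case False
    define c where "c = 1 / real (size M)"
    have c: "c \<noteq> 0" using False by (simp add: c_def)
    have avg: "c *\<^sub>R real_vec (\<Sum>u\<in>#K. g u) \<in> affine hull P \<and>
        f (c *\<^sub>R real_vec (\<Sum>u\<in>#K. g u)) = c *\<^sub>R real_vec (\<Sum>\<^sub># K)"
      if K: "set_mset K \<subseteq> ?B" "size K = size M" for K
    proof -
      let ?K = "image_mset (\<lambda>u. real_vec (g u)) K"
      have "set_mset ?K \<subseteq> affine hull P"
        using K(1) g(1) P_hull by (auto simp: lattice_points_def)
      moreover have "?K \<noteq> {#}"
        using K(2) False by auto
      moreover have "(\<Sum>x\<in>#?K. f x) = real_vec (\<Sum>\<^sub># K)"
      proof -
        have "(\<Sum>x\<in>#?K. f x) = (\<Sum>u\<in>#K. real_vec u)"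
          unfolding image_mset.compositionality o_def
          by (rule arg_cong[where f = sum_mset], rule image_mset_cong) (use K(1) g(2) in auto)
        then show ?thesis
          using sum_mset_real_vec[of "\<lambda>u. u" K] by simp
      qed
      ultimately show ?thesis
        using affine_map_on_average[OF affine_affine_hull f(1), of ?K] K(2)
        by (simp add: c_def sum_mset_real_vec)
    qed
    note M = avg[OF MN(1) HOL.refl] and N = avg[OF MN(2) MN(3)[symmetric]]
    show ?thesis
    proof
      assume "(\<Sum>u\<in>#M. g u) = (\<Sum>u\<in>#N. g u)"
      then have "c *\<^sub>R real_vec (\<Sum>\<^sub># M) = c *\<^sub>R real_vec (\<Sum>\<^sub># N)"
        using M N by metis
      then show "\<Sum>\<^sub># M = \<Sum>\<^sub># N"
        using c by (simp add: real_vec_inject)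
    next
      assume "\<Sum>\<^sub># M = \<Sum>\<^sub># N"
      then have "c *\<^sub>R real_vec (\<Sum>u\<in>#M. g u) = c *\<^sub>R real_vec (\<Sum>u\<in>#N. g u)"
        using M N by (intro inj) auto
      then show "(\<Sum>u\<in>#M. g u) = (\<Sum>u\<in>#N. g u)"
        using c by (simp add: real_vec_inject)
    qed
  qed (use MN in simp)
  let ?Y = "{#even_perm 1, even_perm 2, even_perm 3#}" and ?Z = "{#odd_perm 1, odd_perm 2, odd_perm 3#}"
  have YZ: "set_mset ?Y \<subseteq> ?B" "set_mset ?Z \<subseteq> ?B"
    using Birkhoff3.mem by (auto simp: lattice_points_def)
  let ?c = "term_of 1 (image_mset g ?Y) - term_of 1 (image_mset g ?Z)"
  have "toric_ideal_generated_by P {?c}"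
  proof (rule toric_ideal_generated_byI)
    have "?c \<in> toric_ideal P"
      using YZ g(1) sums[OF YZ] Birkhoff3.sum_three by (intro binomial_in_toric_ideal) auto
    then show "{?c} \<subseteq> toric_ideal P" by simp
    fix J assume J: "ideal J (poly_ring ?X)" "{?c} \<subseteq> J"
    interpret X: multiset_congruence ?X "binomial_rel ?X J"
      by (rule multiset_congruence_binomial_rel[OF J(1)])
    let ?R = "\<lambda>M N. binomial_rel ?X J (image_mset g M) (image_mset g N)"
    have "multiset_congruence ?B ?R"
    proof
      fix M N K :: "(int ^ (3 \<times> 3)) multiset"
      show "?R M M" if "set_mset M \<subseteq> ?B"
        using that g(1) by (intro X.refl) auto
      show "?R N M" if "?R M N"
        using that by (rule X.sym)
      show "?R M K" if "?R M N" "?R N K"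
        using that by (rule X.trans)
      show "?R (M + K) (N + K)" if "?R M N" "set_mset K \<subseteq> ?B"
        unfolding image_mset_union using that g(1)
        by (intro X.add[OF that(1)]) (simp only: set_image_mset, blast)
    qed
    moreover have "?R ?Y ?Z"
      using J(2) YZ g(1) by (auto simp: binomial_rel_def)
    moreover have "0 \<le> coord_fun (1, rc, 0) m" if "m \<in> ?B" for m rc
      using Birkhoff3_nonneg[of "real_vec m" rc] that by (simp add: lattice_points_def real_vec_nth)
    ultimately have connected: "?R M N"
      if "set_mset M \<subseteq> ?B" "set_mset N \<subseteq> ?B" "size M = size N" "\<Sum>\<^sub># M = \<Sum>\<^sub># N" for M N
      using Birkhoff3.factorizations_connected[of ?R M N] that by blast
    have preimage: "\<exists>M'. set_mset M' \<subseteq> ?B \<and> M = image_mset g M'" if "set_mset M \<subseteq> ?X" for M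
      using that
    proof (induction M)
      case (add m M)
      then obtain M' u where "set_mset M' \<subseteq> ?B" "M = image_mset g M'" "u \<in> ?B" "m = g u"
        using surj[of m] by auto
      then show ?case
        by (intro exI[of _ "add_mset u M'"]) auto
    qed simp
    show "toric_ideal P \<subseteq> J"
    proof (rule toric_ideal_le[OF J(1)])
      fix M N
      assume MN: "set_mset M \<subseteq> ?X" "set_mset N \<subseteq> ?X" "size M = size N" "\<Sum>\<^sub># M = \<Sum>\<^sub># N"
      obtain M' where M': "set_mset M' \<subseteq> ?B" "M = image_mset g M'"
        using preimage[OF MN(1)] by blast
      obtain N' where N': "set_mset N' \<subseteq> ?B" "N = image_mset g N'"
        using preimage[OF MN(2)] by blast
      show "binomial_rel ?X J M N"
        using connected[of M' N'] sums[of M' N'] M' N' MN by simp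
    qed
  qed
  \<comment> \<open>Under \<open>f\<close> the variables of one monomial become even permutations
    and those of the other odd ones, so the monomials differ.\<close>
  moreover have "?c \<noteq> 0"
  proof
    assume "?c = 0"
    then have "monom_of (image_mset g ?Y) = monom_of (image_mset g ?Z)"
      by (metis eq_iff_diff_eq_0 keys_single singleton_inject zero_neq_one)
    then have "image_mset g ?Y = image_mset g ?Z"
      by (simp only: monom_of_inject)
    then have "g (even_perm 1) \<in># image_mset g ?Z"
      by (metis image_mset_add_mset union_single_eq_member)
    then obtain j where "g (even_perm 1) = g (odd_perm j)" by auto
    moreover have "even_perm 1 \<in> ?B" "odd_perm j \<in> ?B"
      using Birkhoff3.mem by (simp_all only: lattice_points_def mem_Collect_eq)
    ultimately have "real_vec (even_perm 1) = real_vec (odd_perm j)"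
      using g(2) by metis
    then have "even_perm 1 = odd_perm j"
      by (simp only: real_vec_inject)
    then show False
      using Birkhoff3.y_neq_z by blast
  qed
  moreover have "homogeneous_of_degree 3 ?c"
    unfolding homogeneous_of_degree_def
  proof
    fix \<mu> assume "\<mu> \<in> Poly_Mapping.keys ?c"
    then have "\<mu> = monom_of (image_mset g ?Y) \<or> \<mu> = monom_of (image_mset g ?Z)"
      using keys_diff[of "term_of 1 (image_mset g ?Y)" "term_of 1 (image_mset g ?Z)"] by auto
    then show "monom_degree \<mu> = 3"
      by (auto simp only: monom_degree_monom_of) auto
  qed
  \<comment> \<open>The set of quadrics is empty: the cubic generates alone.\<close>
  ultimately show ?thesis
    unfolding generated_by_cubic_and_quadrics_def by (intro exI[of _ ?c] exI[of _ "{}"]) simp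
qed

section \<open>Obstructions in dimension four\<close>

context quadratic_congruence
begin

text \<open>
  Trading \<open>y p + y q\<close> for \<open>(y p + y q - z j) + z j\<close>, where \<open>{i, p, q}\<close> are all indices, moves \<open>t i j\<close>
  to the value \<open>- 1\<close>; this stays inside the polytope once \<open>t i j\<close> is negative somewhere on it.
\<close>

lemma connected_if_negative:
  assumes "crossing_points P y z t"
    and lo: "\<And>a. a \<in> arcs Q \<Longrightarrow> 0 \<le> lo $ a"
    and box: "\<And>i a. y i $ a \<in> {lo $ a, lo $ a + 1} \<and> z i $ a \<in> {lo $ a, lo $ a + 1}"
    and x: "x \<in> P" "coord_fun (t i j) x < 0"
  shows "{#y 1, y 2, y 3#} \<sim> {#z 1, z 2, z 3#}"
proof -
  interpret crossing_points P y z t by fact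
  \<comment> \<open>Rotates the indices so that \<open>i\<close> or \<open>j\<close> comes first; in
    the type \<open>3\<close> the numerals 4 and 5 equal 1 and 2.\<close>
  have three: "{#u 1, u 2, u 3#} = {#u l, u (l + 1), u (l + 2)#}" for u :: "3 \<Rightarrow> int ^ 'e" and l
  proof -
    have "u 4 = u 1" "u 5 = u 2" by (rule arg_cong; simp)+
    then show ?thesis
      using exhaust_3[of l] by (auto simp: add_mset_commute)
  qed
  have sum3: "\<Sum>\<^sub># {#y i, y (i + 1), y (i + 2)#} = \<Sum>\<^sub># {#z j, z (j + 1), z (j + 2)#}"
    using sum_three three[of y i] three[of z j] by metis
  have X: "y l \<in> X" "z l \<in> X" for l
    using mem by (auto simp: lattice_points_def)
  define A where "A = y (i + 1) + y (i + 2) - z j"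
  have "A \<in> X"
    unfolding lattice_points_iff
  proof (intro conjI ballI allI impI)
    show "is_flow A"
      using X by (simp add: A_def lattice_points_iff is_flow_def net_flow_add net_flow_diff)
    show "A $ a = 0" if "a \<notin> arcs Q" for a
      using X that by (simp add: A_def lattice_points_iff)
    show "0 \<le> A $ a" if a: "a \<in> arcs Q" for a
    proof (rule ccontr)
      assume neg: "\<not> 0 \<le> A $ a"
      have "\<Sum>\<^sub># {#y i, y (i + 1), y (i + 2)#} $ a = \<Sum>\<^sub># {#z j, z (j + 1), z (j + 2)#} $ a"
        by (simp only: sum3)
      then have sum_a: "y i $ a + y (i + 1) $ a + y (i + 2) $ a = z j $ a + z (j + 1) $ a + z (j + 2) $ a"
        by simp
      have bounds: "lo $ a \<le> y l $ a" "y l $ a \<le> lo $ a + 1" "lo $ a \<le> z l $ a" "z l $ a \<le> lo $ a + 1" for l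
        using box[of l a] by auto
      have neg_a: "y (i + 1) $ a + y (i + 2) $ a < z j $ a"
        using neg by (simp add: A_def)
      \<comment> \<open>A negative entry gives \<open>2 * lo < lo + 1\<close> at \<open>a\<close>,
        so \<open>lo\<close> is 0 there; then \<open>z j\<close> is 1, the two subtracted-from
        entries are 0, and equality of the sums settles the rest.\<close>
      have vals: "y i $ a = 1" "y (i + 1) $ a = 0" "y (i + 2) $ a = 0"
        "z j $ a = 1" "z (j + 1) $ a = 0" "z (j + 2) $ a = 0"
        using neg_a sum_a lo[OF a] bounds[of i] bounds[of "i + 1"] bounds[of "i + 2"]
          bounds[of j] bounds[of "j + 1"] bounds[of "j + 2"]
        by linarith+
      have cyc: "l = k \<or> l = k + 1 \<or> l = k + 2" for k l :: 3
        using exhaust_3[of k] exhaust_3[of l] by auto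
      have ya: "y l $ a = of_bool (l = i)" for l
        using cyc[of l i] vals(1-3) by auto
      have za: "z l $ a = of_bool (l = j)" for l
        using cyc[of l j] vals(4-6) by auto
      obtain b c where bc: "(\<Sum>i\<in>UNIV. b i) + (\<Sum>i\<in>UNIV. c i) = 1" "x = comb b c"
        using affine_hull_comb[OF hull_inc[OF x(1)]] .
      \<comment> \<open>Coordinate \<open>a\<close> now agrees with \<open>t i j\<close> at all six
        points, hence on their affine hull. It is therefore negative at \<open>x\<close>, which the
        polytope excludes.\<close>
      have "x $ a = b i + c j"
        using coord_fun_comb[OF bc(1), of 1 a 0] bc(2) ya za
        by (simp add: of_bool_def if_distrib[of "\<lambda>x. _ * x"] if_distrib[of real_of_int] cong: if_cong)
      also have "\<dots> = coord_fun (t i j) x"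
        by (simp add: bc cross_comb)
      finally have "x $ a < 0"
        using x(2) by simp
      with x(1) a show False
        by (simp add: quiver_polytope_def not_le[symmetric])
    qed
  qed
  \<comment> \<open>Two quadratic moves suffice: first the two \<open>y\<close> other than
    \<open>y i\<close> become \<open>A\<close> and \<open>z j\<close>, then \<open>y i\<close> and
    \<open>A\<close> become the two remaining \<open>z\<close>.\<close>
  have "{#y (i + 1), y (i + 2)#} \<sim> {#A, z j#}"
    using X \<open>A \<in> X\<close> by (intro quadratic) (auto simp: A_def)
  then have 1: "{#y i, y (i + 1), y (i + 2)#} \<sim> {#y i, A, z j#}"
    using add[of "{#y (i + 1), y (i + 2)#}" "{#A, z j#}" "{#y i#}"] X by (simp add: add_mset_commute)
  have "y i + A = z (j + 1) + z (j + 2)"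
    using sum3 by (simp add: A_def algebra_simps)
  then have "{#y i, A#} \<sim> {#z (j + 1), z (j + 2)#}"
    using X \<open>A \<in> X\<close> by (intro quadratic) auto
  then have "{#y i, A, z j#} \<sim> {#z j, z (j + 1), z (j + 2)#}"
    using add[of "{#y i, A#}" "{#z (j + 1), z (j + 2)#}" "{#z j#}"] X by (simp add: add_mset_commute)
  with 1 show ?thesis
    unfolding three[of y i] three[of z j] by (rule trans)
qed

text \<open>The dimension bound leaves \<open>k = 3\<close>, and the six points already span. A
  negative value of some \<open>t i j\<close> would connect them by
  \<open>connected_if_negative\<close>, so the functions are nonnegative and the criterion
  \<open>equivalent_Birkhoff3\<close> applies.\<close>

lemma equivalent_Birkhoff3_if_not_connected:
  assumes dim: "aff_dim P = 4"
    and MN: "set_mset M \<subseteq> X" "set_mset N \<subseteq> X" "size M = size N" "\<Sum>\<^sub># M = \<Sum>\<^sub># N" "\<not> M \<sim> N"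
  shows "integral_affinely_equivalent P Birkhoff3"
proof -
  obtain k y z t lo where k: "3 \<le> k" and obs: "obstruction k y z t lo"
    using exists_obstruction[OF MN] by blast
  have "k = 3"
    using obstruction_aff_dim[OF obs k] dim k by simp
  note obs = obs[unfolded \<open>k = 3\<close>]
  \<comment> \<open>Translates the elements 1, 2, 3 of the type \<open>3\<close> into the indices 0,
    1, 2 of the obstruction.\<close>
  define idx :: "3 \<Rightarrow> nat" where "idx i = (if i = 1 then 0 else if i = 2 then 1 else 2)" for i
  have idx: "idx i < 3" "idx i = idx l \<longleftrightarrow> i = l" for i l
    using exhaust_3[of i] exhaust_3[of l] by (auto simp: idx_def)
  have UNIV_idx: "n < 3 \<Longrightarrow> n \<in> range idx" for n
    using idx_def[of 1] idx_def[of 2] idx_def[of 3] by (auto simp: image_iff less_Suc_eq numeral_3_eq_3 intro: exI[of _ 1] exI[of _ 2] exI[of _ 3])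
  have upto3: "{..<3 :: nat} = {0, 1, 2}" by auto
  define y' z' t' where "y' = y \<circ> idx" and "z' = z \<circ> idx" and "t' i j = t (idx i) (idx j)" for i j
  let ?S = "range (\<lambda>i. real_vec (y' i)) \<union> range (\<lambda>i. real_vec (z' i))"
  have inP: "real_vec (y n) \<in> P" "real_vec (z n) \<in> P" if "n < 3" for n
    using obs that by (auto simp: obstruction_def lattice_points_def)
  have cross: "coord_fun (t i j) (y l) = of_bool (l = i) \<and> coord_fun (t i j) (z l) = of_bool (l = j)"
    if "i < 3" "j < 3" "l < 3" for i j l
    using obs that by (simp add: obstruction_def)
  have "?S \<subseteq> P"
    using inP idx by (auto simp: y'_def z'_def)
  have "real_vec (y n) \<in> ?S \<and> real_vec (z n) \<in> ?S" if "n < 3" for n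
    using UNIV_idx[OF that] by (auto simp: y'_def z'_def)
  \<comment> \<open>The dimension bound applied to the six points themselves: their hull has
    dimension 4 and so fills the affine hull of the polytope.\<close>
  then have "2 * int 3 - 2 \<le> aff_dim ?S"
    by (intro aff_dim_ge_crossing[of 3 y _ z t] cross) auto
  moreover have "aff_dim ?S \<le> aff_dim P"
    by (rule aff_dim_subset) fact
  ultimately have "affine hull ?S = affine hull P"
    using dim \<open>?S \<subseteq> P\<close>
    by (intro affine_dim_equal) (auto simp: aff_dim_affine_hull hull_mono)
  then have P_sub: "P \<subseteq> affine hull ?S"
    by (simp add: hull_subset)
  have crossing: "crossing_points P y' z' t'"
  proof
    fix i j l
    show "real_vec (y' i) \<in> P" "real_vec (z' i) \<in> P"
      using inP idx by (auto simp: y'_def z'_def)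
    show "coord_fun (t' i j) (y' l) = of_bool (l = i)" "coord_fun (t' i j) (z' l) = of_bool (l = j)"
      using cross[of "idx i" "idx j" "idx l"] idx by (auto simp: y'_def z'_def t'_def)
  next
    have "(\<Sum>i<3. y i) = (\<Sum>i<3. z i)"
      using obs by (simp add: obstruction_def)
    then show "(\<Sum>i\<in>UNIV. y' i) = (\<Sum>i\<in>UNIV. z' i)"
      by (simp add: sum_3 y'_def z'_def idx_def upto3 add.assoc)
  qed (rule P_sub)
  have msets: "image_mset u (mset_set {..<3}) = {#(u \<circ> idx) 1, (u \<circ> idx) 2, (u \<circ> idx) 3#}" for u :: "nat \<Rightarrow> int ^ 'e"
    by (simp add: upto3 idx_def)
  have "\<not> {#y' 1, y' 2, y' 3#} \<sim> {#z' 1, z' 2, z' 3#}"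
    using obs unfolding obstruction_def msets y'_def z'_def by blast
  moreover have "y' i $ a \<in> {lo $ a, lo $ a + 1} \<and> z' i $ a \<in> {lo $ a, lo $ a + 1}" for i a
    using obs idx(1)[of i] unfolding obstruction_def y'_def z'_def o_def by blast
  moreover have "0 \<le> lo $ a" if "a \<in> arcs Q" for a
    using obs that by (simp add: obstruction_def)
  ultimately have "0 \<le> coord_fun (t' i j) x" if "x \<in> P" for x i j
    using connected_if_negative[OF crossing, of lo x i j] that by (meson not_le)
  then show ?thesis
    using crossing_points.equivalent_Birkhoff3[OF crossing convex_quiver_polytope] by blast
qed

end

theorem theorem4p13:
  fixes Q :: "('v, 'e::finite) pre_digraph" and \<theta> :: "'v \<Rightarrow> int"
  assumes "fin_digraph Q"
    and "acyclic_quiver Q"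
    and "quiver_polytope Q \<theta> \<noteq> {}"
  shows "(aff_dim (quiver_polytope Q \<theta>) \<le> 3 \<longrightarrow>
            generated_in_degree_two (quiver_polytope Q \<theta>)) \<and>
         (aff_dim (quiver_polytope Q \<theta>) = 4 \<longrightarrow>
            (generated_in_degree_two (quiver_polytope Q \<theta>) \<or>
             integral_affinely_equivalent (quiver_polytope Q \<theta>) Birkhoff3) \<and>
            (integral_affinely_equivalent (quiver_polytope Q \<theta>) Birkhoff3 \<longrightarrow>
             generated_by_cubic_and_quadrics (quiver_polytope Q \<theta>)))"
proof -
  let ?P = "quiver_polytope Q \<theta>"
  interpret weighted_quiver Q \<theta>
    using assms(1) by (simp add: weighted_quiver_def)
  have congruence: "quadratic_congruence Q \<theta> R"
    if "multiset_congruence (lattice_points ?P) R"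
      "\<And>p q p' q'. {p, q, p', q'} \<subseteq> lattice_points ?P \<Longrightarrow> p + q = p' + q' \<Longrightarrow> R {#p, q#} {#p', q'#}"
    for R
    using that weighted_quiver_axioms
    by (simp add: quadratic_congruence_def quadratic_congruence_axioms_def)
  show ?thesis
  proof (intro conjI impI Birkhoff3_cubic)
    assume dim: "aff_dim ?P \<le> 3"
    show "generated_in_degree_two ?P"
    proof (rule generated_in_degree_twoI, rule ccontr)
      fix R M N
      assume R: "multiset_congruence (lattice_points ?P) R"
        "\<And>p q p' q'. {p, q, p', q'} \<subseteq> lattice_points ?P \<Longrightarrow> p + q = p' + q' \<Longrightarrow> R {#p, q#} {#p', q'#}"
        and MN: "set_mset M \<subseteq> lattice_points ?P" "set_mset N \<subseteq> lattice_points ?P"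
          "size M = size N" "\<Sum>\<^sub># M = \<Sum>\<^sub># N" "\<not> R M N"
      interpret quadratic_congruence Q \<theta> R
        by (rule congruence[OF R])
      \<comment> \<open>An obstruction needs dimension at least \<open>2 * k - 2\<close>, which is
        at least 4.\<close>
      obtain k y z t lo where "3 \<le> k" "obstruction k y z t lo"
        using exists_obstruction[OF MN] by blast
      then show False
        using obstruction_aff_dim[of k y z t lo] dim by linarith
    qed
  next
    assume dim: "aff_dim ?P = 4"
    show "generated_in_degree_two ?P \<or> integral_affinely_equivalent ?P Birkhoff3"
    proof (rule disjCI, rule generated_in_degree_twoI, rule ccontr)
      fix R M N
      assume not: "\<not> integral_affinely_equivalent ?P Birkhoff3"
        and R: "multiset_congruence (lattice_points ?P) R"
        "\<And>p q p' q'. {p, q, p', q'} \<subseteq> lattice_points ?P \<Longrightarrow> p + q = p' + q' \<Longrightarrow> R {#p, q#} {#p', q'#}"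
        and MN: "set_mset M \<subseteq> lattice_points ?P" "set_mset N \<subseteq> lattice_points ?P"
          "size M = size N" "\<Sum>\<^sub># M = \<Sum>\<^sub># N" "\<not> R M N"
      interpret quadratic_congruence Q \<theta> R
        by (rule congruence[OF R])
      show False
        using equivalent_Birkhoff3_if_not_connected[OF dim MN] not by blast
    qed
  qed
qed

end
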